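(* Let $\mathsf{V}$ be a semigroup pseudovariety closed under bideterministic product, let $A$ be a finite alphabet, and let $\pi,\rho\in\overline{\Omega}_A\mathsf{S}$ be such that $\mathsf{V}\models \pi=\rho$. Suppose that $$\pi= u_0\cdot\pi_1\cdot u_1\cdot\pi_2\cdots \pi_{n-1}\cdot u_{n-1}\cdot \pi_n\cdot u_n,$$ $$\rho= v_0\cdot\rho_1\cdot v_1\cdot\rho_2\cdots \rho_{m-1}\cdot v_{m-1}\cdot \rho_m\cdot v_m$$ are factorizations that are multiregularly organized in $\mathsf{V}$ and organized with short $\mathsf{V}$-breaks. Then $n=m$, $u_i=v_i$ for every $i\in\{0,1,\ldots,n\}$, and $\mathsf{V}\models \pi_j=\rho_j$ for every $j\in\{1,\ldots,n\}$.
   Context: All alphabets are finite. A semigroup pseudovariety is a class of finite semigroups closed under subsemigroups, homomorphic images and finite direct products; $\mathsf{S}$ is the pseudovariety of all finite semigroups. $\overline{\Omega}_A\mathsf{V}$ is the free pro-$\mathsf{V}$ semigroup on $A$ (elements of $\overline{\Omega}_A\mathsf{S}$ are called pseudowords). For $u\in\overline{\Omega}_A\mathsf{S}$, $[u]_{\mathsf{V}}$ is its image under the continuous homomorphism $\overline{\Omega}_A\mathsf{S}\to\overline{\Omega}_A\mathsf{V}$ sending each letter to itself; $\mathsf{V}\models u=v$ means that $[u]_{\mathsf{V}}=[v]_{\mathsf{V}}$ (equivalently, every continuous homomorphism from $\overline{\Omega}_A\mathsf{S}$ to a member of $\mathsf{V}$ identifies $u$ and $v$). $A^+$ (resp. $A^*$)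 is the free semigroup (resp. monoid) on $A$; $A^+$ is viewed inside $\overline{\Omega}_A\mathsf{S}$. Closure under bideterministic product. A language $L\subseteq A^*$ is a prefix code (resp. suffix code) if $uA^+\cap L=\emptyset$ (resp. $A^+u\cap L=\emptyset$) for all $u\in L$. A language $L\subseteq A^+$ is $\mathsf{V}$-recognizable if $L=\varphi^{-1}(\varphi(L))$ for some homomorphism $\varphi\colon A^+\to S$ with $S\in\mathsf{V}$. $\mathsf{V}$ is closed under bideterministic product if, for every alphabet $A$ and letter $a\in A$, $LaK$ is $\mathsf{V}$-recognizable whenever each of $L,K$ is either a $\mathsf{V}$-recognizable subset of $A^+$ or equal to $\{1\}$, $La$ is a prefix code and $aK$ is a suffix code. Multiregular pseudowords. An element $s$ of a semigroup $S$ is regular if $s\in sSs$. A pseudoword $\pi\in\overline{\Omega}_A\mathsf{S}$ is $\mathsf{V}$-multiregular if $[\pi]_{\mathsf{V}}$ is a finite product of regular elements of $\overline{\Omega}_A\mathsf{V}$. Green quasi-orders. For a semigroup $S$, let $S^I$ be $S$ with a new neutral element adjoined; $s\le_{\mathcal R}t$ iff $s\in tS^I$, $s\le_{\mathcal L}t$ iff $s\in S^It$; $<_{\mathcal R}$ and $<_{\mathcal L}$ denote the strict versions ($s<_{\mathcal K}t$ iff $s\le_{\mathcal K}t$ and not $t\le_{\mathcal K}s$). For $u\in A^+$, $\mathsf{i}_1(u)$ and $\mathsf{t}_1(u)$ are the first and last letters of $u$. Organized factorizations. Consider a factorization $\pi=u_0\cdot\pi_1\cdot u_1\cdots u_{n-1}\cdot\pi_n\cdot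 u_n$ of $\pi\in\overline{\Omega}_A\mathsf{S}$ with $n\ge 0$, $u_0,u_n\in A^*$, $u_i\in A^+$ for $1\le i\le n-1$, $\pi_i\in\overline{\Omega}_A\mathsf{S}\setminus A^+$ for $1\le i\le n$ (if $n=0$ the factorization is $\pi=u_0$). It is multiregularly organized in $\mathsf{V}$ if every $\pi_i$ is $\mathsf{V}$-multiregular. It is organized with short $\mathsf{V}$-breaks if (vacuously when $n=0$): (1) $[\pi_i\,\mathsf{i}_1(u_i)]_{\mathsf{V}}<_{\mathcal R}[\pi_i]_{\mathsf{V}}$ for $1\le i\le n-1$; (2) $[\mathsf{t}_1(u_i)\,\pi_{i+1}]_{\mathsf{V}}<_{\mathcal L}[\pi_{i+1}]_{\mathsf{V}}$ for $1\le i\le n-1$; (3) if $u_0\neq 1$ then $[\mathsf{t}_1(u_0)\,\pi_1]_{\mathsf{V}}<_{\mathcal L}[\pi_1]_{\mathsf{V}}$; (4) if $u_n\neq 1$ then $[\pi_n\,\mathsf{i}_1(u_n)]_{\mathsf{V}}<_{\mathcal R}[\pi_n]_{\mathsf{V}}$; the inequalities being in the semigroup $\overline{\Omega}_A\mathsf{V}$. *)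

theory Defs
  imports "HOL-Algebra.Congruence" "HOL-Analysis.Analysis"
begin

section \<open>Semigroups\<close>

record 'a semigrp = "'a partial_object" +
  smult :: "'a \<Rightarrow> 'a \<Rightarrow> 'a"  (infixl \<open>\<cdot>\<index>\<close> 70)

definition is_semigrp :: "'a semigrp \<Rightarrow> bool" where
  "is_semigrp S \<longleftrightarrow> carrier S \<noteq> {} \<and>
     (\<forall>x\<in>carrier S. \<forall>y\<in>carrier S. x \<cdot>\<^bsub>S\<^esub> y \<in> carrier S) \<and>
     (\<forall>x\<in>carrier S. \<forall>y\<in>carrier S. \<forall>z\<in>carrier S.
        (x \<cdot>\<^bsub>S\<^esub> y) \<cdot>\<^bsub>S\<^esub> z = x \<cdot>\<^bsub>S\<^esub> (y \<cdot>\<^bsub>S\<^esub> z))"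

definition semigrp_hom :: "'a semigrp \<Rightarrow> 'b semigrp \<Rightarrow> ('a \<Rightarrow> 'b) set" where
  "semigrp_hom S T = {f \<in> carrier S \<rightarrow> carrier T.
     \<forall>x\<in>carrier S. \<forall>y\<in>carrier S. f (x \<cdot>\<^bsub>S\<^esub> y) = f x \<cdot>\<^bsub>T\<^esub> f y}"

definition prod_semigrp :: "'a semigrp \<Rightarrow> 'b semigrp \<Rightarrow> ('a \<times> 'b) semigrp" where
  "prod_semigrp S T = \<lparr>carrier = carrier S \<times> carrier T,
     smult = (\<lambda>x y. (fst x \<cdot>\<^bsub>S\<^esub> fst y, snd x \<cdot>\<^bsub>T\<^esub> snd y))\<rparr>"

fun sprod :: "'a semigrp \<Rightarrow> 'a list \<Rightarrow> 'a" where
  "sprod S [x] = x"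
| "sprod S (x # y # ys) = x \<cdot>\<^bsub>S\<^esub> sprod S (y # ys)"

text \<open>\<open>S\<^sup>I\<close>: the new neutral element is \<^const>\<open>None\<close>; it is new even if \<open>S\<close> already has one.\<close>

definition adj_id :: "'a semigrp \<Rightarrow> 'a option semigrp" where
  "adj_id S = \<lparr>carrier = insert None (Some ` carrier S),
     smult = (\<lambda>x y. case x of None \<Rightarrow> y
       | Some a \<Rightarrow> (case y of None \<Rightarrow> Some a | Some b \<Rightarrow> Some (a \<cdot>\<^bsub>S\<^esub> b)))\<rparr>"

definition le_R :: "'a semigrp \<Rightarrow> 'a \<Rightarrow> 'a \<Rightarrow> bool" where
  "le_R S s t \<longleftrightarrow> (\<exists>x\<in>carrier (adj_id S). Some s = Some t \<cdot>\<^bsub>adj_id S\<^esub> x)"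

definition le_L :: "'a semigrp \<Rightarrow> 'a \<Rightarrow> 'a \<Rightarrow> bool" where
  "le_L S s t \<longleftrightarrow> (\<exists>x\<in>carrier (adj_id S). Some s = x \<cdot>\<^bsub>adj_id S\<^esub> Some t)"

definition less_R :: "'a semigrp \<Rightarrow> 'a \<Rightarrow> 'a \<Rightarrow> bool" where
  "less_R S s t \<longleftrightarrow> le_R S s t \<and> \<not> le_R S t s"

definition less_L :: "'a semigrp \<Rightarrow> 'a \<Rightarrow> 'a \<Rightarrow> bool" where
  "less_L S s t \<longleftrightarrow> le_L S s t \<and> \<not> le_L S t s"

definition regular_elem :: "'a semigrp \<Rightarrow> 'a \<Rightarrow> bool" where
  "regular_elem S s \<longleftrightarrow> s \<in> carrier S \<and> (\<exists>x\<in>carrier S. s = s \<cdot>\<^bsub>S\<^esub> x \<cdot>\<^bsub>S\<^esub> s)"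


section \<open>Pseudovarieties\<close>

text \<open>Every finite semigroup is isomorphic to one whose carrier is a set of natural numbers, and
  a pseudovariety is closed under isomorphism; so classes of finite semigroups are represented
  by their members with carrier in \<^typ>\<open>nat\<close>. Closure under isomorphic copies (and
  insensitivity to the values of the multiplication off the carrier) is part of closure
  under homomorphic images. A product of two members lives on pairs of natural numbers, hence
  the reference to its isomorphic copies; the one-element semigroups are the empty products.\<close>

definition fin_semigrps :: "nat semigrp set" where
  "fin_semigrps = {S. is_semigrp S \<and> finite (carrier S)}"

definition pseudovariety :: "nat semigrp set \<Rightarrow> bool" where
  "pseudovariety V \<longleftrightarrow> V \<subseteq> fin_semigrps \<and>
     (\<forall>S\<in>V. \<forall>T\<in>fin_semigrps.
        carrier T \<subseteq> carrier S \<and> smult T = smult S \<longrightarrow> T \<in> V) \<and>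
     (\<forall>S\<in>V. \<forall>T\<in>fin_semigrps.
        (\<exists>f\<in>semigrp_hom S T. f ` carrier S = carrier T) \<longrightarrow> T \<in> V) \<and>
     (\<forall>T\<in>fin_semigrps. card (carrier T) = 1 \<longrightarrow> T \<in> V) \<and>
     (\<forall>S\<in>V. \<forall>S'\<in>V. \<forall>T\<in>fin_semigrps.
        (\<exists>f\<in>semigrp_hom (prod_semigrp S S') T.
           bij_betw f (carrier (prod_semigrp S S')) (carrier T)) \<longrightarrow> T \<in> V)"


section \<open>Languages and the bideterministic product\<close>

definition words :: "'a set \<Rightarrow> 'a list set" where
  "words A = {w \<in> lists A. w \<noteq> []}"

definition word_semigrp :: "'a set \<Rightarrow> 'a list semigrp" where
  "word_semigrp A = \<lparr>carrier = words A, smult = (@)\<rparr>"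

definition recognizable :: "nat semigrp set \<Rightarrow> 'a set \<Rightarrow> 'a list set \<Rightarrow> bool" where
  "recognizable V A L \<longleftrightarrow> L \<subseteq> words A \<and>
     (\<exists>S\<in>V. \<exists>\<phi>\<in>semigrp_hom (word_semigrp A) S. L = {w \<in> words A. \<phi> w \<in> \<phi> ` L})"

definition prefix_code :: "'a set \<Rightarrow> 'a list set \<Rightarrow> bool" where
  "prefix_code A L \<longleftrightarrow> L \<subseteq> lists A \<and> (\<forall>u\<in>L. {u @ w | w. w \<in> words A} \<inter> L = {})"

definition suffix_code :: "'a set \<Rightarrow> 'a list set \<Rightarrow> bool" where
  "suffix_code A L \<longleftrightarrow> L \<subseteq> lists A \<and> (\<forall>u\<in>L. {w @ u | w. w \<in> words A} \<inter> L = {})"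

text \<open>Quantifying over alphabets that are finite sets of natural numbers covers
  all finite alphabets up to renaming of letters.\<close>

definition bidet_closed :: "nat semigrp set \<Rightarrow> bool" where
  "bidet_closed V \<longleftrightarrow> (\<forall>(A :: nat set) a L K.
     finite A \<and> a \<in> A \<and>
     (recognizable V A L \<or> L = {[]}) \<and> (recognizable V A K \<or> K = {[]}) \<and>
     prefix_code A {x @ [a] | x. x \<in> L} \<and> suffix_code A {a # y | y. y \<in> K}
     \<longrightarrow> recognizable V A {x @ [a] @ y | x y. x \<in> L \<and> y \<in> K})"


section \<open>Free pro-\<open>V\<close> semigroups\<close>

text \<open>The free pro-\<open>V\<close> semigroup on \<open>A\<close> is constructed as the closure of the image of
  \<open>A\<^sup>+\<close> in the topological product of all the (discrete) semigroups \<open>S\<close> in \<open>V\<close>,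
  one factor for each map \<open>\<phi>\<close> from \<open>A\<close> to \<open>S\<close>. The \<open>(S, \<phi>)\<close>-component of
  an element is its value under the continuous homomorphism into \<open>S\<close> extending \<open>\<phi>\<close>;
  see \<open>Omega_universal\<close> below.\<close>

type_synonym 'a pseudoword = "nat semigrp \<times> ('a \<Rightarrow> nat) \<Rightarrow> nat"

definition pro_index :: "nat semigrp set \<Rightarrow> 'a set \<Rightarrow> (nat semigrp \<times> ('a \<Rightarrow> nat)) set" where
  "pro_index V A = {(S, \<phi>). S \<in> V \<and> \<phi> \<in> A \<rightarrow>\<^sub>E carrier S}"

definition pro_top :: "nat semigrp set \<Rightarrow> 'a set \<Rightarrow> 'a pseudoword topology" where
  "pro_top V A = product_topology (\<lambda>(S, \<phi>). discrete_topology (carrier S)) (pro_index V A)"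

definition pword :: "nat semigrp set \<Rightarrow> 'a set \<Rightarrow> 'a list \<Rightarrow> 'a pseudoword" where
  "pword V A w = (\<lambda>(S, \<phi>) \<in> pro_index V A. sprod S (map \<phi> w))"

definition Omega :: "nat semigrp set \<Rightarrow> 'a set \<Rightarrow> 'a pseudoword semigrp" where
  "Omega V A = \<lparr>carrier = pro_top V A closure_of (pword V A ` words A),
     smult = (\<lambda>x y. \<lambda>(S, \<phi>) \<in> pro_index V A. x (S, \<phi>) \<cdot>\<^bsub>S\<^esub> y (S, \<phi>))\<rparr>"

definition Omega_top :: "nat semigrp set \<Rightarrow> 'a set \<Rightarrow> 'a pseudoword topology" where
  "Omega_top V A = subtopology (pro_top V A) (carrier (Omega V A))"

text \<open>\<open>proj V A u\<close> is \<open>[u]\<^sub>V\<close>. It forgets the components outside \<open>V\<close>; that this is the continuous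
  homomorphism fixing the letters is \<open>proj_characterization\<close> below.\<close>

definition proj :: "nat semigrp set \<Rightarrow> 'a set \<Rightarrow> 'a pseudoword \<Rightarrow> 'a pseudoword" where
  "proj V A u = restrict u (pro_index V A)"

definition models :: "nat semigrp set \<Rightarrow> 'a set \<Rightarrow> 'a pseudoword \<Rightarrow> 'a pseudoword \<Rightarrow> bool" where
  "models V A u v \<longleftrightarrow> proj V A u = proj V A v"


subsection \<open>The construction has the expected properties\<close>

lemma words_append: "u \<in> words A \<Longrightarrow> v \<in> words A \<Longrightarrow> u @ v \<in> words A"
  by (auto simp: words_def)

lemma sprod_closed:
  assumes "is_semigrp S" "xs \<noteq> []" "set xs \<subseteq> carrier S"
  shows "sprod S xs \<in> carrier S"
  using assms by (induction S xs rule: sprod.induct) (auto simp: is_semigrp_def)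

lemma sprod_append:
  assumes "is_semigrp S" "xs \<noteq> []" "set xs \<subseteq> carrier S" "ys \<noteq> []" "set ys \<subseteq> carrier S"
  shows "sprod S (xs @ ys) = sprod S xs \<cdot>\<^bsub>S\<^esub> sprod S ys"
  using assms
proof (induction S xs rule: sprod.induct)
  case (1 S x)
  then show ?case by (cases ys) auto
next
  case (2 S x y zs)
  have "sprod S (y # zs) \<in> carrier S" "sprod S ys \<in> carrier S"
    using 2 by (auto intro!: sprod_closed)
  then show ?case using 2 by (simp add: is_semigrp_def)
qed auto

lemma pro_index_D:
  assumes "V \<subseteq> fin_semigrps" "(S, \<phi>) \<in> pro_index V A"
  shows "is_semigrp S" "S \<in> V" "a \<in> A \<Longrightarrow> \<phi> a \<in> carrier S"
  using assms by (auto simp: pro_index_def fin_semigrps_def)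

lemma pword_append:
  assumes "V \<subseteq> fin_semigrps" "u \<in> words A" "v \<in> words A"
  shows "pword V A (u @ v) = pword V A u \<cdot>\<^bsub>Omega V A\<^esub> pword V A v"
proof -
  have "sprod S (map \<phi> (u @ v)) = sprod S (map \<phi> u) \<cdot>\<^bsub>S\<^esub> sprod S (map \<phi> v)"
    if "(S, \<phi>) \<in> pro_index V A" for S \<phi>
    using assms pro_index_D[OF assms(1) that]
    by (simp add: words_def) (rule sprod_append, auto)
  then show ?thesis
    by (auto simp: pword_def Omega_def fun_eq_iff)
qed

lemma pword_in_top:
  assumes "V \<subseteq> fin_semigrps"
  shows "pword V A ` words A \<subseteq> topspace (pro_top V A)"
proof -
  have "sprod S (map \<phi> w) \<in> carrier S" if "(S, \<phi>) \<in> pro_index V A" "w \<in> words A" for S \<phi> w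
    using that pro_index_D[OF assms that(1)] by (intro sprod_closed) (auto simp: words_def)
  then show ?thesis
    by (auto simp: pro_top_def pword_def)
qed

lemma pword_in_Omega:
  assumes "V \<subseteq> fin_semigrps" "w \<in> words A"
  shows "pword V A w \<in> carrier (Omega V A)"
  using closure_of_subset[OF pword_in_top[OF assms(1)]] assms(2)
  by (auto simp: Omega_def)

lemma Omega_ext:
  assumes "x \<in> carrier (Omega V A)"
  shows "x \<in> extensional (pro_index V A)"
    and "(S, \<phi>) \<in> pro_index V A \<Longrightarrow> x (S, \<phi>) \<in> carrier S"
proof -
  have "x \<in> topspace (pro_top V A)"
    using assms in_closure_of by (fastforce simp: Omega_def)
  then show "x \<in> extensional (pro_index V A)"
    and "(S, \<phi>) \<in> pro_index V A \<Longrightarrow> x (S, \<phi>) \<in> carrier S"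
    by (auto simp: pro_top_def PiE_iff)
qed

lemma topspace_Omega_top [simp]: "topspace (Omega_top V A) = carrier (Omega V A)"
  using closure_of_subset_topspace by (fastforce simp: Omega_top_def Omega_def)

lemma compact_Omega:
  assumes "V \<subseteq> fin_semigrps"
  shows "compact_space (Omega_top V A)" and "Hausdorff_space (Omega_top V A)"
proof -
  have "compact_space (pro_top V A)" unfolding pro_top_def
    using assms by (subst compact_space_product_topology)
      (auto simp: compact_space_discrete_topology pro_index_def fin_semigrps_def)
  then show "compact_space (Omega_top V A)"
    unfolding Omega_top_def
    by (intro compact_space_subtopology closedin_compact_space) (auto simp: Omega_def)
  show "Hausdorff_space (Omega_top V A)" unfolding Omega_top_def pro_top_def
    by (intro Hausdorff_space_subtopology) (auto simp: Hausdorff_space_product_topology)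
qed

lemma Omega_smult_continuous:
  assumes "V \<subseteq> fin_semigrps"
  shows "continuous_map (prod_topology (pro_top V A) (pro_top V A)) (pro_top V A)
           (\<lambda>(x, y). x \<cdot>\<^bsub>Omega V A\<^esub> y)"
proof -
  have "continuous_map (prod_topology (pro_top V A) (pro_top V A))
          (discrete_topology (carrier S)) (\<lambda>p. fst p (S, \<phi>) \<cdot>\<^bsub>S\<^esub> snd p (S, \<phi>))"
    if i: "(S, \<phi>) \<in> pro_index V A" for S \<phi>
  proof -
    have "continuous_map (pro_top V A) (discrete_topology (carrier S)) (\<lambda>x. x (S, \<phi>))"
      unfolding pro_top_def
      using continuous_map_product_projection[OF i,
          of "\<lambda>(S, \<phi>). discrete_topology (carrier S)"] by simp
    then have "continuous_map (prod_topology (pro_top V A) (pro_top V A))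
        (prod_topology (discrete_topology (carrier S)) (discrete_topology (carrier S)))
        (\<lambda>p. (fst p (S, \<phi>), snd p (S, \<phi>)))"
      by (auto simp: continuous_map_pairwise o_def
          intro: continuous_map_compose[OF continuous_map_fst, unfolded o_def]
                 continuous_map_compose[OF continuous_map_snd, unfolded o_def])
    moreover have "continuous_map
        (prod_topology (discrete_topology (carrier S)) (discrete_topology (carrier S)))
        (discrete_topology (carrier S)) (\<lambda>p. fst p \<cdot>\<^bsub>S\<^esub> snd p)"
      using pro_index_D(1)[OF assms i]
      by (auto simp: prod_topology_discrete_topology[symmetric] is_semigrp_def)
    ultimately show ?thesis
      using continuous_map_compose by (fastforce simp: o_def)
  qed
  then show ?thesis
    unfolding pro_top_def continuous_map_componentwise
    by (auto simp: Omega_def case_prod_unfold)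
qed

lemma Omega_semigrp:
  assumes V: "V \<subseteq> fin_semigrps" and A: "A \<noteq> {}"
  shows "is_semigrp (Omega V A)"
proof -
  let ?P = "pword V A ` words A"
  obtain a where "a \<in> A" using A by blast
  then have ne: "carrier (Omega V A) \<noteq> {}"
    using pword_in_Omega[OF V, of "[a]" A] by (auto simp: words_def)
  have "x \<cdot>\<^bsub>Omega V A\<^esub> y \<in> carrier (Omega V A)"
    if xy: "x \<in> carrier (Omega V A)" "y \<in> carrier (Omega V A)" for x y
  proof -
    have "(x, y) \<in> prod_topology (pro_top V A) (pro_top V A) closure_of (?P \<times> ?P)"
      using xy by (simp add: Omega_def closure_of_Times)
    then have "(\<lambda>(x, y). x \<cdot>\<^bsub>Omega V A\<^esub> y) (x, y) \<in>
        pro_top V A closure_of ((\<lambda>(x, y). x \<cdot>\<^bsub>Omega V A\<^esub> y) ` (?P \<times> ?P))"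
      using continuous_map_image_closure_subset[OF Omega_smult_continuous[OF V]] by blast
    moreover have "(\<lambda>(x, y). x \<cdot>\<^bsub>Omega V A\<^esub> y) ` (?P \<times> ?P) \<subseteq> ?P"
      using pword_append[OF V, symmetric] words_append by fastforce
    ultimately show ?thesis
      using closure_of_mono by (fastforce simp: Omega_def)
  qed
  moreover have "(x \<cdot>\<^bsub>Omega V A\<^esub> y) \<cdot>\<^bsub>Omega V A\<^esub> z = x \<cdot>\<^bsub>Omega V A\<^esub> (y \<cdot>\<^bsub>Omega V A\<^esub> z)"
    if xyz: "x \<in> carrier (Omega V A)" "y \<in> carrier (Omega V A)" "z \<in> carrier (Omega V A)" for x y z
  proof -
    have "(x (S, \<phi>) \<cdot>\<^bsub>S\<^esub> y (S, \<phi>)) \<cdot>\<^bsub>S\<^esub> z (S, \<phi>) = x (S, \<phi>) \<cdot>\<^bsub>S\<^esub> (y (S, \<phi>) \<cdot>\<^bsub>S\<^esub> z (S, \<phi>))"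
      if i: "(S, \<phi>) \<in> pro_index V A" for S \<phi>
      using pro_index_D(1)[OF V i] xyz[THEN Omega_ext(2), OF i] by (simp add: is_semigrp_def)
    then show ?thesis by (auto simp: Omega_def fun_eq_iff)
  qed
  ultimately show ?thesis
    using ne by (simp add: is_semigrp_def)
qed

text \<open>A continuous homomorphism into a Hausdorff semigroup is determined by its values on letters.\<close>

lemma Omega_hom_unique:
  assumes V: "V \<subseteq> fin_semigrps" and T: "Hausdorff_space X"
    and f: "f \<in> semigrp_hom (Omega V A) S" "continuous_map (Omega_top V A) X f"
    and g: "g \<in> semigrp_hom (Omega V A) S" "continuous_map (Omega_top V A) X g"
    and fg: "\<And>a. a \<in> A \<Longrightarrow> f (pword V A [a]) = g (pword V A [a])"
    and x: "x \<in> carrier (Omega V A)"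
  shows "f x = g x"
proof -
  have *: "f (pword V A w) = g (pword V A w)" if "w \<in> words A" for w
    using that
  proof (induction w)
    case (Cons a w)
    show ?case
    proof (cases "w = []")
      case False
      then have w: "[a] \<in> words A" "w \<in> words A" using Cons.prems by (auto simp: words_def)
      then have "pword V A (a # w) = pword V A [a] \<cdot>\<^bsub>Omega V A\<^esub> pword V A w"
        using pword_append[OF V w] by simp
      moreover have "pword V A [a] \<in> carrier (Omega V A)" "pword V A w \<in> carrier (Omega V A)"
        using w pword_in_Omega[OF V] by auto
      moreover have "f (pword V A w) = g (pword V A w)" "f (pword V A [a]) = g (pword V A [a])"
        using w Cons.IH fg[of a] by (auto simp: words_def)
      ultimately show ?thesis
        using f(1) g(1) by (simp add: semigrp_hom_def)
    qed (use fg Cons.prems in \<open>auto simp: words_def\<close>)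
  qed (auto simp: words_def)
  have "x \<in> Omega_top V A closure_of (pword V A ` words A)"
  proof -
    have "carrier (Omega V A) \<inter> pword V A ` words A = pword V A ` words A"
      using pword_in_Omega[OF V] by blast
    then show ?thesis
      using x unfolding Omega_top_def closure_of_subtopology by (simp add: Omega_def)
  qed
  then show ?thesis
    by (rule forall_in_closure_of_eq[OF _ T f(2) g(2)]) (use * in auto)
qed

lemma Omega_universal:
  assumes V: "V \<subseteq> fin_semigrps" and S: "S \<in> V" and \<phi>: "\<phi> \<in> A \<rightarrow> carrier S"
  shows "\<exists>!f. f \<in> semigrp_hom (Omega V A) S \<and> f \<in> extensional (carrier (Omega V A)) \<and>
    continuous_map (Omega_top V A) (discrete_topology (carrier S)) f \<and>
    (\<forall>a\<in>A. f (pword V A [a]) = \<phi> a)"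
proof (rule ex_ex1I)
  let ?i = "(S, restrict \<phi> A)"
  let ?f = "restrict (\<lambda>x. x ?i) (carrier (Omega V A))"
  have i: "?i \<in> pro_index V A" using S \<phi> by (auto simp: pro_index_def)
  have ev: "continuous_map (Omega_top V A) (discrete_topology (carrier S)) (\<lambda>x. x ?i)"
    unfolding Omega_top_def pro_top_def
    using continuous_map_product_projection[OF i,
        of "\<lambda>(S, \<phi>). discrete_topology (carrier S)"]
    by (intro continuous_map_from_subtopology) simp
  have c: "continuous_map (Omega_top V A) (discrete_topology (carrier S)) ?f"
    by (rule continuous_map_eq[OF ev]) simp
  have "A \<noteq> {}" if "x \<in> carrier (Omega V A)" for x
    using that by (auto simp: Omega_def words_def)
  then have cl: "x \<cdot>\<^bsub>Omega V A\<^esub> y \<in> carrier (Omega V A)"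
    if "x \<in> carrier (Omega V A)" "y \<in> carrier (Omega V A)" for x y
    using Omega_semigrp[OF V, of A] that \<open>\<And>x. x \<in> carrier (Omega V A) \<Longrightarrow> A \<noteq> {}\<close>
    unfolding is_semigrp_def by blast
  have "(x \<cdot>\<^bsub>Omega V A\<^esub> y) ?i = x ?i \<cdot>\<^bsub>S\<^esub> y ?i" for x y
    using i by (simp add: Omega_def)
  then have h: "?f \<in> semigrp_hom (Omega V A) S"
    using cl i Omega_ext(2) by (auto simp: semigrp_hom_def)
  have "?f (pword V A [a]) = \<phi> a" if "a \<in> A" for a
    using that i pword_in_Omega[OF V, of "[a]" A] by (simp add: words_def) (simp add: pword_def)
  with c h show "\<exists>f. f \<in> semigrp_hom (Omega V A) S \<and> f \<in> extensional (carrier (Omega V A)) \<and>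
    continuous_map (Omega_top V A) (discrete_topology (carrier S)) f \<and>
    (\<forall>a\<in>A. f (pword V A [a]) = \<phi> a)" by (intro exI[of _ ?f]) auto
next
  fix f g
  assume f: "f \<in> semigrp_hom (Omega V A) S \<and> f \<in> extensional (carrier (Omega V A)) \<and>
      continuous_map (Omega_top V A) (discrete_topology (carrier S)) f \<and>
      (\<forall>a\<in>A. f (pword V A [a]) = \<phi> a)"
    and g: "g \<in> semigrp_hom (Omega V A) S \<and> g \<in> extensional (carrier (Omega V A)) \<and>
      continuous_map (Omega_top V A) (discrete_topology (carrier S)) g \<and>
      (\<forall>a\<in>A. g (pword V A [a]) = \<phi> a)"
  show "f = g"
  proof (rule extensionalityI[of _ "carrier (Omega V A)"])
    show "f x = g x" if "x \<in> carrier (Omega V A)" for x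
      by (rule Omega_hom_unique[OF V Hausdorff_space_discrete_topology, of f A S "carrier S" g x])
        (use f g that in auto)
  qed (use f g in auto)
qed

text \<open>The continuous homomorphism of \<open>proj_characterization\<close> is unique by
  \<open>Omega_hom_unique\<close> and \<open>compact_Omega\<close>.\<close>

lemma proj_characterization:
  assumes V: "V \<subseteq> fin_semigrps"
  shows "proj V A \<in> semigrp_hom (Omega fin_semigrps A) (Omega V A)"
    and "continuous_map (Omega_top fin_semigrps A) (Omega_top V A) (proj V A)"
    and "proj V A (pword fin_semigrps A w) = pword V A w"
proof -
  have sub: "pro_index V A \<subseteq> pro_index fin_semigrps A" using V by (auto simp: pro_index_def)
  show w: "proj V A (pword fin_semigrps A w) = pword V A w" for w
    using sub by (auto simp: proj_def pword_def fun_eq_iff)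
  have c: "continuous_map (pro_top fin_semigrps A) (pro_top V A) (proj V A)"
    unfolding pro_top_def continuous_map_componentwise
  proof (intro conjI ballI)
    fix i assume i: "i \<in> pro_index V A"
    then have "continuous_map
        (product_topology (\<lambda>(S, \<phi>). discrete_topology (carrier S)) (pro_index fin_semigrps A))
        ((\<lambda>(S, \<phi>). discrete_topology (carrier S)) i) (\<lambda>x. x i)"
      using sub by (intro continuous_map_product_projection) auto
    then show "continuous_map
        (product_topology (\<lambda>(S, \<phi>). discrete_topology (carrier S)) (pro_index fin_semigrps A))
        ((\<lambda>(S, \<phi>). discrete_topology (carrier S)) i) (\<lambda>x. proj V A x i)"
      using i by (simp add: proj_def)
  qed (auto simp: proj_def)
  have im: "proj V A ` carrier (Omega fin_semigrps A) \<subseteq> carrier (Omega V A)"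
  proof -
    have "proj V A ` carrier (Omega fin_semigrps A) \<subseteq>
        pro_top V A closure_of (proj V A ` pword fin_semigrps A ` words A)"
      using continuous_map_image_closure_subset[OF c] by (simp add: Omega_def)
    also have "proj V A ` pword fin_semigrps A ` words A = pword V A ` words A"
      using w by (simp add: image_image)
    finally show ?thesis by (simp add: Omega_def)
  qed
  show "continuous_map (Omega_top fin_semigrps A) (Omega_top V A) (proj V A)"
    using im c unfolding Omega_top_def
    by (auto simp: continuous_map_in_subtopology continuous_map_from_subtopology
        dest: subsetD[OF closure_of_subset_topspace])
  show "proj V A \<in> semigrp_hom (Omega fin_semigrps A) (Omega V A)"
    using im sub by (auto simp: semigrp_hom_def proj_def fun_eq_iff Omega_def)
qed


section \<open>Multiregular pseudowords and organized factorizations\<close>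

definition multiregular :: "nat semigrp set \<Rightarrow> 'a set \<Rightarrow> 'a pseudoword \<Rightarrow> bool" where
  "multiregular V A \<pi> \<longleftrightarrow>
     (\<exists>rs. rs \<noteq> [] \<and> (\<forall>r\<in>set rs. regular_elem (Omega V A) r) \<and>
           proj V A \<pi> = sprod (Omega V A) rs)"

text \<open>Factorizations are evaluated in \<open>S\<^sup>I\<close> for \<open>S\<close> the semigroup of pseudowords,
  where the empty word is interpreted as the adjoined neutral element.\<close>

definition word_val :: "'a set \<Rightarrow> 'a list \<Rightarrow> 'a pseudoword option" where
  "word_val A w = (if w = [] then None else Some (pword fin_semigrps A w))"

primrec fact_val ::
  "'a set \<Rightarrow> (nat \<Rightarrow> 'a list) \<Rightarrow> (nat \<Rightarrow> 'a pseudoword) \<Rightarrow> nat \<Rightarrow> 'a pseudoword option" where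
  "fact_val A u p 0 = word_val A (u 0)"
| "fact_val A u p (Suc k) =
     fact_val A u p k \<cdot>\<^bsub>adj_id (Omega fin_semigrps A)\<^esub> Some (p (Suc k))
       \<cdot>\<^bsub>adj_id (Omega fin_semigrps A)\<^esub> word_val A (u (Suc k))"

text \<open>\<open>factorization A \<pi> n u p\<close>: \<open>\<pi> = u 0 \<cdot> p 1 \<cdot> u 1 \<cdots> u (n-1) \<cdot> p n \<cdot> u n\<close>. The values of \<open>u\<close> and \<open>p\<close>
  at other indices (in particular \<open>p 0\<close>) are irrelevant.\<close>

definition factorization ::
  "'a set \<Rightarrow> 'a pseudoword \<Rightarrow> nat \<Rightarrow> (nat \<Rightarrow> 'a list) \<Rightarrow> (nat \<Rightarrow> 'a pseudoword) \<Rightarrow> bool" where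
  "factorization A \<pi> n u p \<longleftrightarrow>
     u 0 \<in> lists A \<and> u n \<in> lists A \<and> (\<forall>i\<in>{1..<n}. u i \<in> words A) \<and>
     (\<forall>i\<in>{1..n}. p i \<in> carrier (Omega fin_semigrps A) - pword fin_semigrps A ` words A) \<and>
     Some \<pi> = fact_val A u p n"

definition multiregularly_organized ::
  "nat semigrp set \<Rightarrow> 'a set \<Rightarrow> nat \<Rightarrow> (nat \<Rightarrow> 'a pseudoword) \<Rightarrow> bool" where
  "multiregularly_organized V A n p \<longleftrightarrow> (\<forall>i\<in>{1..n}. multiregular V A (p i))"

definition right_break :: "nat semigrp set \<Rightarrow> 'a set \<Rightarrow> 'a pseudoword \<Rightarrow> 'a \<Rightarrow> bool" where
  "right_break V A \<pi> a \<longleftrightarrow>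
     less_R (Omega V A)
       (proj V A (\<pi> \<cdot>\<^bsub>Omega fin_semigrps A\<^esub> pword fin_semigrps A [a])) (proj V A \<pi>)"

definition left_break :: "nat semigrp set \<Rightarrow> 'a set \<Rightarrow> 'a \<Rightarrow> 'a pseudoword \<Rightarrow> bool" where
  "left_break V A a \<pi> \<longleftrightarrow>
     less_L (Omega V A)
       (proj V A (pword fin_semigrps A [a] \<cdot>\<^bsub>Omega fin_semigrps A\<^esub> \<pi>)) (proj V A \<pi>)"

definition short_breaks ::
  "nat semigrp set \<Rightarrow> 'a set \<Rightarrow> nat \<Rightarrow> (nat \<Rightarrow> 'a list) \<Rightarrow> (nat \<Rightarrow> 'a pseudoword) \<Rightarrow> bool" where
  "short_breaks V A n u p \<longleftrightarrow>
     (\<forall>i\<in>{1..<n}. right_break V A (p i) (hd (u i))) \<and>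
     (\<forall>i\<in>{1..<n}. left_break V A (last (u i)) (p (i + 1))) \<and>
     (n > 0 \<and> u 0 \<noteq> [] \<longrightarrow> left_break V A (last (u 0)) (p 1)) \<and>
     (n > 0 \<and> u n \<noteq> [] \<longrightarrow> right_break V A (p n) (hd (u n)))"

end

theory Submission
  imports Defs
begin

text \<open>
  All computations take place in the monoid \<open>M\<close> obtained from the free pro-\<open>V\<close> semigroup by adjoining
  a neutral element. A good cut of an element of \<open>M\<close> is a factorization \<open>x a y\<close>, where \<open>a\<close> is a letter,
  such that \<open>x a <\<^sub>R x\<close> and \<open>a y <\<^sub>L y\<close>. The letters of the words \<open>u\<^sub>i\<close> in a factorization of the
  kind considered in the theorem turn out to be exactly the good cuts of its value, and since the value
  knows its good cuts, it determines the factorization.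

  The link with closure under bideterministic product is this. By compactness, \<open>x a <\<^sub>R x\<close> is
  witnessed in a finite quotient. The language \<open>L\<close> of all words with the same image as \<open>x\<close> in that quotient
  is such that \<open>L a\<close> is a prefix code. Dually, \<open>y\<close> yields a language \<open>K\<close> such that \<open>a K\<close> is a suffix code.
  So \<open>L a K\<close> is recognizable and its closure is a neighbourhood of \<open>x a y\<close>, while each word in it has only one
  factorization in \<open>L a K\<close> (\<open>good_cut_neighbourhood\<close>). Approximating pseudowords by words, one gets that
  if \<open>x a y = x' y'\<close>, then the cut at \<open>a\<close> is inside \<open>x'\<close> or inside \<open>y'\<close> (\<open>good_cut_split\<close>), and that
  either side of a good cut can be cancelled (\<open>good_cut_cancel_left\<close>, \<open>good_cut_cancel_right\<close>).

  The rest is algebra. A regular element has no good cut (\<open>regular_unbroken\<close>), hence neither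
  has a product of regular elements (\<open>unbroken_mult\<close>). On the other hand, short breaks together with
  cancellation make every letter between the blocks a good cut of the whole
  (\<open>organized_falls_L\<close>). Comparing two factorizations of the same element, the first letter
  of one of them is therefore found in the other, with the same elements to its left and to its right
  (\<open>locate_cut\<close>), and the comparison proceeds by induction (\<open>organized_unique\<close>).
\<close>

section \<open>Monoids with good cuts\<close>

text \<open>In a monoid, \<open>falls_R M x b\<close> says that \<open>x b <\<^sub>R x\<close> and \<open>falls_L M b y\<close> that \<open>b y <\<^sub>L y\<close>. A
  factorization \<open>x b y\<close> with both properties is called a good cut at \<open>b\<close>. The monoid will be
  of the form \<open>S\<^sup>I\<close>, so that either side of a cut may be empty.\<close>

definition falls_R :: "'m semigrp \<Rightarrow> 'm \<Rightarrow> 'm \<Rightarrow> bool" where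
  "falls_R M x b \<longleftrightarrow> (\<forall>z\<in>carrier M. x \<cdot>\<^bsub>M\<^esub> b \<cdot>\<^bsub>M\<^esub> z \<noteq> x)"

definition falls_L :: "'m semigrp \<Rightarrow> 'm \<Rightarrow> 'm \<Rightarrow> bool" where
  "falls_L M b y \<longleftrightarrow> (\<forall>z\<in>carrier M. z \<cdot>\<^bsub>M\<^esub> b \<cdot>\<^bsub>M\<^esub> y \<noteq> y)"

datatype ('a, 'm) token = Letter 'a | Block 'm

text \<open>The last three axioms are the consequences of closure under bideterministic product from which
  everything else is derived by algebra: a good cut of a product of two elements lies in one of the
  factors, and the two sides of a good cut can be cancelled.\<close>

locale letter_cuts =
  fixes M :: "'m semigrp" (structure) and e :: 'm and A :: "'a set" and l :: "'a \<Rightarrow> 'm"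
  assumes closed [simp, intro]: "x \<in> carrier M \<Longrightarrow> y \<in> carrier M \<Longrightarrow> x \<cdot> y \<in> carrier M"
    and assoc [simp]: "x \<in> carrier M \<Longrightarrow> y \<in> carrier M \<Longrightarrow> z \<in> carrier M \<Longrightarrow> (x \<cdot> y) \<cdot> z = x \<cdot> (y \<cdot> z)"
    and unit_in [simp, intro]: "e \<in> carrier M"
    and unit_left [simp]: "x \<in> carrier M \<Longrightarrow> e \<cdot> x = x"
    and unit_right [simp]: "x \<in> carrier M \<Longrightarrow> x \<cdot> e = x"
    and unit_irreducible:
      "x \<in> carrier M \<Longrightarrow> y \<in> carrier M \<Longrightarrow> x \<cdot> y = e \<Longrightarrow> x = e \<and> y = e"
    and letter_in [simp, intro]: "a \<in> A \<Longrightarrow> l a \<in> carrier M"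
    and letter_not_unit: "a \<in> A \<Longrightarrow> l a \<noteq> e"
    and letter_inj: "a \<in> A \<Longrightarrow> b \<in> A \<Longrightarrow> l a = l b \<Longrightarrow> a = b"
    and split: "\<lbrakk>x \<in> carrier M; y \<in> carrier M; x' \<in> carrier M; y' \<in> carrier M; a \<in> A;
       falls_R M x (l a); falls_L M (l a) y; x' \<cdot> y' = x \<cdot> (l a \<cdot> y)\<rbrakk> \<Longrightarrow>
       (\<exists>t\<in>carrier M. x' = x \<cdot> (l a \<cdot> t) \<and> y = t \<cdot> y') \<or>
       (\<exists>s\<in>carrier M. x = x' \<cdot> s \<and> y' = s \<cdot> (l a \<cdot> y))"
    and cancel_left: "\<lbrakk>x \<in> carrier M; y \<in> carrier M; y' \<in> carrier M; a \<in> A;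
       falls_R M x (l a); falls_L M (l a) y; x \<cdot> (l a \<cdot> y) = x \<cdot> (l a \<cdot> y')\<rbrakk> \<Longrightarrow> y = y'"
    and cancel_right: "\<lbrakk>x \<in> carrier M; x' \<in> carrier M; y \<in> carrier M; a \<in> A;
       falls_R M x (l a); falls_L M (l a) y; x \<cdot> (l a \<cdot> y) = x' \<cdot> (l a \<cdot> y)\<rbrakk> \<Longrightarrow> x = x'"
begin

definition unbroken :: "'m \<Rightarrow> bool" where
  "unbroken x \<longleftrightarrow> (\<forall>s\<in>carrier M. \<forall>t\<in>carrier M. \<forall>a\<in>A.
     falls_R M s (l a) \<and> falls_L M (l a) t \<longrightarrow> x \<noteq> s \<cdot> (l a \<cdot> t))"

lemma unit_falls:
  assumes "a \<in> A" shows "falls_R M e (l a)" "falls_L M (l a) e"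
proof -
  have "e \<cdot> l a \<cdot> z \<noteq> e" "z \<cdot> l a \<cdot> e \<noteq> e" if "z \<in> carrier M" for z
    using unit_irreducible[of "l a" z] unit_irreducible[of z "l a"] letter_not_unit[of a] assms that
    by simp_all metis+
  then show "falls_R M e (l a)" "falls_L M (l a) e" by (simp_all add: falls_R_def falls_L_def)
qed

lemma falls_R_suffix:
  assumes "falls_R M (x \<cdot> s) (l a)" "x \<in> carrier M" "s \<in> carrier M" "a \<in> A"
  shows "falls_R M s (l a)"
  using assms unfolding falls_R_def by (metis assoc closed letter_in)

lemma falls_L_prefix:
  assumes "falls_L M (l a) (t \<cdot> y)" "y \<in> carrier M" "t \<in> carrier M" "a \<in> A"
  shows "falls_L M (l a) t"
  using assms unfolding falls_L_def by (metis assoc closed letter_in)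

text \<open>If \<open>x = s a t\<close> is a good cut and \<open>x = x y x\<close>, then \<open>s a t = s a (t y x)\<close>, so that
  \<open>t = t y x = (t y s) a t\<close> by cancellation, which contradicts \<open>a t <\<^sub>L t\<close>.\<close>

lemma regular_unbroken:
  assumes xy: "x \<in> carrier M" "y \<in> carrier M" "x = x \<cdot> (y \<cdot> x)"
  shows "unbroken x"
  unfolding unbroken_def
proof (intro ballI impI notI)
  fix s t a assume st: "s \<in> carrier M" "t \<in> carrier M" "a \<in> A"
    and f: "falls_R M s (l a) \<and> falls_L M (l a) t" and x: "x = s \<cdot> (l a \<cdot> t)"
  have "s \<cdot> (l a \<cdot> t) = (s \<cdot> (l a \<cdot> t)) \<cdot> (y \<cdot> x)" using xy x by simp
  then have "s \<cdot> (l a \<cdot> t) = s \<cdot> (l a \<cdot> (t \<cdot> (y \<cdot> x)))" using st xy by simp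
  then have "t = t \<cdot> (y \<cdot> x)"
    using f st xy by (intro cancel_left[of s t _ a]) auto
  then have "(t \<cdot> (y \<cdot> s)) \<cdot> l a \<cdot> t = t" using x st xy by simp
  then show False using f st xy unfolding falls_L_def by blast
qed

text \<open>A good cut of a product would be located in one of the two factors, and the part of it
  within that factor is again a good cut.\<close>

lemma unbroken_mult:
  assumes x: "unbroken x" "x \<in> carrier M" and y: "unbroken y" "y \<in> carrier M"
  shows "unbroken (x \<cdot> y)"
  unfolding unbroken_def
proof (intro ballI impI notI)
  fix s t a assume st: "s \<in> carrier M" "t \<in> carrier M" "a \<in> A"
    and f: "falls_R M s (l a) \<and> falls_L M (l a) t" and eq: "x \<cdot> y = s \<cdot> (l a \<cdot> t)"
  consider t' where "t' \<in> carrier M" "x = s \<cdot> (l a \<cdot> t')" "t = t' \<cdot> y"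
    | s' where "s' \<in> carrier M" "s = x \<cdot> s'" "y = s' \<cdot> (l a \<cdot> t)"
    using split[of s t x y a] f st x(2) y(2) eq by auto
  then show False
  proof cases
    case 1
    then show False using x f st y falls_L_prefix[of a t' y] unfolding unbroken_def by blast
  next
    case 2
    then show False using y f st x falls_R_suffix[of x s' a] unfolding unbroken_def by blast
  qed
qed

text \<open>A letter is itself a good cut between two units, which makes it irreducible.\<close>

lemma letter_cut:
  assumes st: "s \<in> carrier M" "t \<in> carrier M" "a \<in> A" "b \<in> A" and eq: "l b = s \<cdot> (l a \<cdot> t)"
  shows "s = e \<and> t = e \<and> a = b"
proof -
  have at: "l a \<cdot> t \<noteq> e" using unit_irreducible[of "l a" t] letter_not_unit st by auto
  have first: "x = e \<or> y = e" if xy: "x \<in> carrier M" "y \<in> carrier M" "x \<cdot> y = l b" for x y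
  proof -
    have "(\<exists>r\<in>carrier M. x = e \<cdot> (l b \<cdot> r) \<and> e = r \<cdot> y) \<or> (\<exists>r\<in>carrier M. e = x \<cdot> r \<and> y = r \<cdot> (l b \<cdot> e))"
      using split[of e e x y b] unit_falls[of b] xy st by simp
    then show ?thesis using unit_irreducible xy by metis
  qed
  have s: "s = e" using first[of s "l a \<cdot> t"] eq at st by simp
  then have "t = e" using first[of "l a" t] eq st letter_not_unit by simp
  with s show ?thesis using eq st letter_inj by simp
qed

subsection \<open>Sequences of letters and blocks\<close>

fun tval :: "('a, 'm) token \<Rightarrow> 'm" where
  "tval (Letter a) = l a"
| "tval (Block x) = x"

definition val :: "('a, 'm) token list \<Rightarrow> 'm" where
  "val ts = foldr (\<lambda>t x. tval t \<cdot> x) ts e"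

fun admissible :: "('a, 'm) token \<Rightarrow> bool" where
  "admissible (Letter a) \<longleftrightarrow> a \<in> A"
| "admissible (Block x) \<longleftrightarrow> x \<in> carrier M \<and> x \<noteq> e \<and> unbroken x"

fun compatible :: "('a, 'm) token \<Rightarrow> ('a, 'm) token \<Rightarrow> bool" where
  "compatible (Letter a) (Letter b) \<longleftrightarrow> True"
| "compatible (Letter a) (Block x) \<longleftrightarrow> falls_L M (l a) x"
| "compatible (Block x) (Letter a) \<longleftrightarrow> falls_R M x (l a)"
| "compatible (Block x) (Block y) \<longleftrightarrow> False"

text \<open>This renders organized factorizations with short breaks: letters are the letters of the words
  \<open>u\<^sub>i\<close> and blocks are the \<open>\<pi>\<^sub>i\<close>. Adjacent blocks are excluded because the inner words \<open>u\<^sub>i\<close> are nonempty.\<close>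

definition organized :: "('a, 'm) token list \<Rightarrow> bool" where
  "organized ts \<longleftrightarrow> (\<forall>t\<in>set ts. admissible t) \<and> successively compatible ts"

lemma val_simps [simp]: "val [] = e" "val (t # ts) = tval t \<cdot> val ts"
  by (simp_all add: val_def)

lemma tval_in: "admissible t \<Longrightarrow> tval t \<in> carrier M"
  by (cases t) auto

lemma val_in: "\<forall>t\<in>set ts. admissible t \<Longrightarrow> val ts \<in> carrier M"
  by (induction ts) (auto simp: tval_in)

lemma val_append:
  "\<lbrakk>\<forall>t\<in>set ts. admissible t; \<forall>t\<in>set us. admissible t\<rbrakk> \<Longrightarrow> val (ts @ us) = val ts \<cdot> val us"
  by (induction ts) (auto simp: val_in tval_in)

lemma organized_append:
  "organized (ts @ us) \<longleftrightarrow> organized ts \<and> organized us \<and>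
     (ts = [] \<or> us = [] \<or> compatible (last ts) (hd us))"
  by (auto simp: organized_def successively_append_iff)

lemma organized_Cons:
  "organized (t # us) \<longleftrightarrow> admissible t \<and> organized us \<and> (us = [] \<or> compatible t (hd us))"
  by (cases us) (auto simp: organized_def)

lemma organized_val_in: "organized ts \<Longrightarrow> val ts \<in> carrier M"
  by (simp add: organized_def val_in)

lemma val_unit:
  assumes "organized ts" "val ts = e"
  shows "ts = []"
proof (cases ts)
  case (Cons t us)
  then have t: "admissible t" "val us \<in> carrier M"
    using assms by (simp_all add: organized_Cons organized_val_in)
  then have "tval t = e" using unit_irreducible[of "tval t" "val us"] Cons assms(2) tval_in by simp
  with t letter_not_unit show ?thesis by (cases t) auto
qed

text \<open>Only breaks between neighbours are assumed, but they imply that every letter gives a good cut of the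
  whole sequence. A return \<open>z a (val ts) = val ts\<close> can be cancelled at the first letter \<open>b\<close> of \<open>ts\<close>,
  the cut at \<open>b\<close> being good by induction. What remains is a return across the block before \<open>b\<close>,
  which the break at \<open>a\<close> forbids, or the equation \<open>z a = 1\<close>.\<close>

lemma organized_falls_L: "organized (Letter a # ts) \<Longrightarrow> falls_L M (l a) (val ts)"
proof (induction ts arbitrary: a rule: length_induct)
  case (1 ts)
  have a: "a \<in> A" using 1 by (simp add: organized_Cons)
  show ?case
  proof (cases ts)
    case Nil
    then show ?thesis using unit_falls a by simp
  next
    case (Cons t us)
    then have us: "organized us" "val us \<in> carrier M" and t: "admissible t" "us = [] \<or> compatible t (hd us)"
      using "1.prems" by (simp_all add: organized_Cons organized_val_in)
    show ?thesis
    proof (cases t)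
      case (Letter b)
      then have b: "b \<in> A" "falls_L M (l b) (val us)" using 1 Cons by (auto simp: organized_Cons)
      have False if z: "z \<in> carrier M" "z \<cdot> l a \<cdot> (l b \<cdot> val us) = l b \<cdot> val us" for z
      proof -
        have "e = z \<cdot> l a"
          using z a b us unit_falls by (intro cancel_right[of e _ "val us" b]) auto
        then show False using unit_irreducible[of z "l a"] z a letter_not_unit letter_in by metis
      qed
      then show ?thesis using Cons Letter unfolding falls_L_def by auto
    next
      case (Block x)
      then have x: "x \<in> carrier M" "falls_L M (l a) x" using 1 Cons t by (auto simp: organized_Cons)
      show ?thesis
      proof (cases us)
        case Nil
        then show ?thesis using Cons Block x by simp
      next
        case (Cons t' vs)
        then obtain b where t': "t' = Letter b" using t Block by (cases t') auto
        then have b: "b \<in> A" "falls_R M x (l b)" "falls_L M (l b) (val vs)" "val vs \<in> carrier M"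
          using "1.prems" "1.IH" Cons t Block \<open>ts = t # us\<close> us
          by (simp_all add: organized_Cons organized_val_in)
        have False if z: "z \<in> carrier M" "z \<cdot> l a \<cdot> (x \<cdot> (l b \<cdot> val vs)) = x \<cdot> (l b \<cdot> val vs)" for z
        proof -
          have "x = z \<cdot> l a \<cdot> x"
            using z a b x by (intro cancel_right[of x _ "val vs" b]) auto
          then show False using x(2) z unfolding falls_L_def by metis
        qed
        then show ?thesis using Cons Block t' \<open>ts = t # us\<close> unfolding falls_L_def by auto
      qed
    qed
  qed
qed

text \<open>The good cuts of the value of an organized sequence sit at letters, as blocks are unbroken. Splitting
  along the sequence finds the letter.\<close>

lemma locate_cut:
  assumes "organized ts" "val ts = s \<cdot> (l a \<cdot> t)"
    and "s \<in> carrier M" "t \<in> carrier M" "a \<in> A" "falls_R M s (l a)" "falls_L M (l a) t"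
  shows "\<exists>us vs. ts = us @ Letter a # vs \<and> val us = s \<and> val vs = t"
  using assms
proof (induction ts arbitrary: s)
  case Nil
  then show ?case
    using unit_irreducible[of s "l a \<cdot> t"] unit_irreducible[of "l a" t] letter_not_unit by auto
next
  case (Cons k ts)
  then have k: "admissible k" "tval k \<in> carrier M" and ts: "organized ts" "val ts \<in> carrier M"
    by (simp_all add: organized_Cons organized_val_in tval_in)
  consider t' where "t' \<in> carrier M" "tval k = s \<cdot> (l a \<cdot> t')" "t = t' \<cdot> val ts"
    | s' where "s' \<in> carrier M" "s = tval k \<cdot> s'" "val ts = s' \<cdot> (l a \<cdot> t)"
    using split[of s t "tval k" "val ts" a] Cons.prems k ts by auto
  then show ?case
  proof cases
    case 1
    then have "falls_L M (l a) t'" using Cons.prems ts falls_L_prefix[of a t' "val ts"] by auto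
    then obtain b where b: "k = Letter b" "b \<in> A"
      using 1 k Cons.prems unfolding unbroken_def by (cases k) (auto simp: unbroken_def)
    then have "s = e \<and> t' = e \<and> a = b" using letter_cut[of s t' a b] 1 Cons.prems by simp
    then show ?thesis using b 1 ts by (intro exI[of _ "[]"] exI[of _ ts]) simp
  next
    case 2
    then have "falls_R M s' (l a)" using Cons.prems k falls_R_suffix[of "tval k" s' a] by auto
    then obtain us vs where "ts = us @ Letter a # vs" "val us = s'" "val vs = t"
      using Cons.IH[of s'] 2 Cons.prems ts by blast
    then show ?thesis using 2 by (intro exI[of _ "k # us"] exI[of _ vs]) simp
  qed
qed

text \<open>Otherwise the first letter of the sequence, which is at the first or second position, would be
  a good cut of the value.\<close>

lemma unbroken_single_block:
  assumes ts: "organized ts" and x: "unbroken (val ts)" "val ts \<noteq> e"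
  shows "ts = [Block (val ts)]"
proof -
  have no: False if "ts = us @ Letter a # vs" "us = [] \<or> (\<exists>y. us = [Block y])" for us a vs
  proof -
    have *: "a \<in> A" "val us \<in> carrier M" "val vs \<in> carrier M" 
      using ts that(1) by (simp_all add: organized_append organized_Cons organized_val_in)
    moreover have "falls_R M (val us) (l a)" 
      using ts that * unit_falls by (auto simp: organized_append organized_Cons)
    moreover have "falls_L M (l a) (val vs)"
      using ts that organized_falls_L by (auto simp: organized_append)
    moreover have "val ts = val us \<cdot> (l a \<cdot> val vs)"
      using that ts by (subst that(1), subst val_append) (auto simp: organized_def)
    ultimately show False using x unfolding unbroken_def by blast
  qed
  obtain t us where t: "ts = t # us" using x by (cases ts) auto
  then obtain y where y: "t = Block y" using no[of "[]"] by (cases t) auto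
  have "us = []"
  proof (cases us)
    case (Cons t' vs)
    then obtain b where "t' = Letter b" using ts t y by (cases t') (auto simp: organized_Cons)
    then show ?thesis using no[of "[Block y]" b vs] t y Cons by auto
  qed
  then show ?thesis using t y ts by (simp add: organized_Cons)
qed

text \<open>The first letter \<open>a\<close> of \<open>ts\<close> is a good cut, hence occurs in \<open>us\<close> with the same value on either side.
  What precedes it in \<open>ts\<close> is empty or a single block, and this is determined by its value; what
  follows it is determined by induction.\<close>

lemma organized_unique:
  assumes "organized ts" "organized us" "val ts = val us"
  shows "ts = us"
  using assms
proof (induction ts arbitrary: us rule: length_induct)
  case (1 ts us)
  \<comment> \<open>Here \<open>a\<close> is the first letter, and \<open>xs\<close> is either empty or one block.\<close>
  have step: ?case
    if ts: "ts = xs @ Letter a # ys" "val xs \<in> carrier M" "falls_R M (val xs) (l a)"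
      and xs: "\<And>vs. organized vs \<Longrightarrow> val vs = val xs \<Longrightarrow> vs = xs" for xs a ys
  proof -
    have ys: "organized ys" "val ys \<in> carrier M" "falls_L M (l a) (val ys)" "a \<in> A"
      using "1.prems"(1) ts(1) organized_falls_L
      by (simp_all add: organized_append organized_Cons organized_val_in)
    have "val us = val xs \<cdot> (l a \<cdot> val ys)"
      using ts "1.prems" by (subst "1.prems"(3)[symmetric], subst ts(1), subst val_append) (auto simp: organized_def)
    then obtain xs' ys' where us: "us = xs' @ Letter a # ys'" "val xs' = val xs" "val ys' = val ys"
      using locate_cut[of us "val xs" a "val ys"] ts ys "1.prems" by blast
    have "organized xs'" "organized ys'" using "1.prems" us by (auto simp: organized_append organized_Cons)
    then have "xs' = xs" "ys = ys'" using xs us "1.IH" ts(1) ys by auto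
    then show ?thesis using us ts by simp
  qed
  show ?case
  proof (cases ts)
    case Nil
    then show ?thesis using "1.prems" val_unit[of us] by simp
  next
    case (Cons t ys)
    show ?thesis
    proof (cases t)
      case (Letter a)
      then show ?thesis
        using step[of "[]" a ys] Cons "1.prems" unit_falls val_unit by (auto simp: organized_Cons)
    next
      case (Block x)
      then have x: "x \<in> carrier M" "x \<noteq> e" "unbroken x"
        using "1.prems" Cons by (auto simp: organized_Cons)
      then have single: "vs = [Block x]" if "organized vs" "val vs = x" for vs
        using unbroken_single_block[of vs] that by auto
      show ?thesis
      proof (cases ys)
        case Nil
        then show ?thesis using single[of us] "1.prems" Cons Block x by simp
      next
        case (Cons t' zs)
        then obtain a where "t' = Letter a" using "1.prems" \<open>ts = t # ys\<close> Block
          by (cases t') (auto simp: organized_Cons)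
        then show ?thesis using step[of "[Block x]" a zs] single "1.prems" \<open>ts = t # ys\<close> Block Cons x
          by (simp add: organized_Cons)
      qed
    qed
  qed
qed

end

section \<open>Recognizable languages\<close>

lemma sprod_hom:
  assumes "is_semigrp S" "h \<in> semigrp_hom S T" "xs \<noteq> []" "set xs \<subseteq> carrier S"
  shows "sprod T (map h xs) = h (sprod S xs)"
  using assms
proof (induction S xs rule: sprod.induct)
  case (2 S x y zs)
  moreover have "sprod S (y # zs) \<in> carrier S" using 2 by (intro sprod_closed) auto
  ultimately show ?case by (simp add: semigrp_hom_def)
qed auto

lemma word_hom_index:
  assumes "S \<in> V" "\<phi> \<in> semigrp_hom (word_semigrp A) S"
  shows "(S, \<lambda>a\<in>A. \<phi> [a]) \<in> pro_index V A"
  using assms by (auto simp: pro_index_def semigrp_hom_def word_semigrp_def words_def Pi_iff)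

lemma word_hom_eq_pword:
  assumes S: "S \<in> V" "\<phi> \<in> semigrp_hom (word_semigrp A) S" and w: "w \<in> words A"
  shows "\<phi> w = pword V A w (S, \<lambda>a\<in>A. \<phi> [a])"
proof -
  have "\<phi> w = sprod S (map (\<lambda>a\<in>A. \<phi> [a]) w)"
    using w
  proof (induction w)
    case (Cons a w)
    show ?case
    proof (cases w)
      case (Cons b v)
      then have "[a] \<in> words A" "w \<in> words A" using Cons.prems by (auto simp: words_def)
      moreover from this have "\<phi> ([a] @ w) = \<phi> [a] \<cdot>\<^bsub>S\<^esub> \<phi> w"
        using S unfolding semigrp_hom_def word_semigrp_def by auto
      ultimately show ?thesis using Cons.IH Cons by (simp add: words_def)
    qed (use Cons.prems in \<open>auto simp: words_def\<close>)
  qed (simp add: words_def)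
  then show ?thesis using word_hom_index[OF S] by (simp add: pword_def)
qed

text \<open>Homomorphisms from \<open>A\<^sup>+\<close> to members of \<open>V\<close> are the same as coordinates of the free pro-\<open>V\<close> semigroup,
  so a language is recognizable if and only if a single coordinate decides membership.\<close>

lemma recognizable_iff:
  assumes V: "V \<subseteq> fin_semigrps"
  shows "recognizable V A L \<longleftrightarrow> L \<subseteq> words A \<and>
    (\<exists>i\<in>pro_index V A. \<exists>C. \<forall>w\<in>words A. w \<in> L \<longleftrightarrow> pword V A w i \<in> C)" (is "_ \<longleftrightarrow> ?R")
proof
  assume "recognizable V A L"
  then obtain S \<phi> where S: "L \<subseteq> words A" "S \<in> V" "\<phi> \<in> semigrp_hom (word_semigrp A) S"
    and L: "L = {w \<in> words A. \<phi> w \<in> \<phi> ` L}" unfolding recognizable_def by blast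
  let ?i = "(S, \<lambda>a\<in>A. \<phi> [a])"
  have "?i \<in> pro_index V A" by (rule word_hom_index[OF S(2,3)])
  moreover have "w \<in> L \<longleftrightarrow> pword V A w ?i \<in> \<phi> ` L" if "w \<in> words A" for w
  proof -
    have "w \<in> L \<longleftrightarrow> \<phi> w \<in> \<phi> ` L" using L that by blast
    then show ?thesis using word_hom_eq_pword[OF S(2,3) that] by simp
  qed
  ultimately show ?R using S(1) by blast
next
  assume ?R
  then obtain S \<phi> C where L: "L \<subseteq> words A" and i: "(S, \<phi>) \<in> pro_index V A"
    and C: "\<And>w. w \<in> words A \<Longrightarrow> w \<in> L \<longleftrightarrow> pword V A w (S, \<phi>) \<in> C" by auto
  let ?f = "\<lambda>w. pword V A w (S, \<phi>)"
  have "?f (u @ w) = ?f u \<cdot>\<^bsub>S\<^esub> ?f w" if "u \<in> words A" "w \<in> words A" for u w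
    using i by (subst pword_append[OF V that]) (simp add: Omega_def)
  then have "?f \<in> semigrp_hom (word_semigrp A) S"
    using Omega_ext(2)[OF pword_in_Omega[OF V] i] by (simp add: semigrp_hom_def word_semigrp_def)
  moreover have *: "w \<in> L" if "w \<in> words A" "w' \<in> L" "?f w = ?f w'" for w w'
    using C[of w] C[of w'] L that by auto
  have "L = {w \<in> words A. ?f w \<in> ?f ` L}"
  proof (intro equalityI subsetI)
    fix w assume "w \<in> {w \<in> words A. ?f w \<in> ?f ` L}"
    then obtain w' where "w \<in> words A" "w' \<in> L" "?f w = ?f w'" by auto
    then show "w \<in> L" by (rule *)
  qed (use L in auto)
  ultimately show "recognizable V A L"
    using pro_index_D(2)[OF V i] L unfolding recognizable_def by (intro conjI bexI[of _ S] bexI[of _ ?f])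
qed

lemma recognizable_Int:
  assumes V: "pseudovariety V" and L: "recognizable V A L" and K: "recognizable V A K"
  shows "recognizable V A (L \<inter> K)"
proof -
  have Vf: "V \<subseteq> fin_semigrps" using V by (simp add: pseudovariety_def)
  obtain S \<phi> C where i: "(S, \<phi>) \<in> pro_index V A" and C: "L \<subseteq> words A"
    "\<And>w. w \<in> words A \<Longrightarrow> w \<in> L \<longleftrightarrow> pword V A w (S, \<phi>) \<in> C"
    using L unfolding recognizable_iff[OF Vf] by auto
  obtain T \<psi> D where j: "(T, \<psi>) \<in> pro_index V A" and D: "K \<subseteq> words A"
    "\<And>w. w \<in> words A \<Longrightarrow> w \<in> K \<longleftrightarrow> pword V A w (T, \<psi>) \<in> D"
    using K unfolding recognizable_iff[OF Vf] by auto
  have S: "is_semigrp S" "finite (carrier S)" "S \<in> V" and T: "is_semigrp T" "finite (carrier T)" "T \<in> V"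
    using i j Vf by (auto simp: pro_index_def fin_semigrps_def)
  let ?P = "prod_semigrp S T"
  have P: "is_semigrp ?P" "finite (carrier ?P)"
    using S T by (auto simp: is_semigrp_def prod_semigrp_def)
  obtain f :: "nat \<times> nat \<Rightarrow> nat" and n where f: "inj_on f (carrier ?P)"
    using finite_imp_inj_to_nat_seg[OF P(2)] by auto
  \<comment> \<open>Members of \<open>V\<close> live on natural numbers, so the product is copied along \<open>f\<close>.\<close>
  let ?g = "inv_into (carrier ?P) f"
  define Q where "Q = \<lparr>carrier = f ` carrier ?P, smult = (\<lambda>x y. f (?g x \<cdot>\<^bsub>?P\<^esub> ?g y))\<rparr>"
  have Q: "is_semigrp Q" "finite (carrier Q)"
    using P f unfolding Q_def is_semigrp_def by simp_all
  have fh: "f \<in> semigrp_hom ?P Q"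
    using f P(1) by (simp add: semigrp_hom_def Q_def)
  have "Q \<in> fin_semigrps" using Q by (simp add: fin_semigrps_def)
  moreover have "bij_betw f (carrier ?P) (carrier Q)" using f by (simp add: Q_def bij_betw_def)
  ultimately have QV: "Q \<in> V" using V S(3) T(3) fh unfolding pseudovariety_def by blast
  let ?\<chi> = "\<lambda>a\<in>A. f (\<phi> a, \<psi> a)"
  have carr: "(\<phi> a, \<psi> a) \<in> carrier ?P" if "a \<in> A" for a
    using i j that by (auto simp: pro_index_def prod_semigrp_def)
  then have k: "(Q, ?\<chi>) \<in> pro_index V A" using QV by (auto simp: pro_index_def Q_def)
  have val: "pword V A w (Q, ?\<chi>) = f (pword V A w (S, \<phi>), pword V A w (T, \<psi>))"
    and val_in: "(pword V A w (S, \<phi>), pword V A w (T, \<psi>)) \<in> carrier ?P" if w: "w \<in> words A" for w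
  proof -
    let ?ps = "map (\<lambda>a. (\<phi> a, \<psi> a)) w"
    have ps: "?ps \<noteq> []" "set ?ps \<subseteq> carrier ?P" using w carr by (auto simp: words_def)
    have "fst \<in> semigrp_hom ?P S" "snd \<in> semigrp_hom ?P T"
      by (auto simp: semigrp_hom_def prod_semigrp_def)
    then have "sprod ?P ?ps = (pword V A w (S, \<phi>), pword V A w (T, \<psi>))"
      using sprod_hom[OF P(1) _ ps, of fst S] sprod_hom[OF P(1) _ ps, of snd T] i j
      by (simp add: pword_def comp_def prod_eq_iff)
    moreover have "map ?\<chi> w = map f ?ps" using w by (auto simp: words_def)
    then have "sprod Q (map ?\<chi> w) = f (sprod ?P ?ps)"
      using sprod_hom[OF P(1) fh ps] by (simp only:)
    then have "pword V A w (Q, ?\<chi>) = f (sprod ?P ?ps)" using k by (simp add: pword_def)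
    ultimately show "pword V A w (Q, ?\<chi>) = f (pword V A w (S, \<phi>), pword V A w (T, \<psi>))"
      "(pword V A w (S, \<phi>), pword V A w (T, \<psi>)) \<in> carrier ?P"
      using sprod_closed[OF P(1) ps] by simp_all
  qed
  have "w \<in> L \<inter> K \<longleftrightarrow> pword V A w (Q, ?\<chi>) \<in> f ` (C \<times> D \<inter> carrier ?P)" if w: "w \<in> words A" for w
  proof -
    have "pword V A w (Q, ?\<chi>) \<in> f ` (C \<times> D \<inter> carrier ?P) \<longleftrightarrow>
        (pword V A w (S, \<phi>), pword V A w (T, \<psi>)) \<in> C \<times> D \<inter> carrier ?P"
      unfolding val[OF w] using inj_on_image_mem_iff[OF f val_in[OF w]] by blast
    then show ?thesis using C(2)[OF w] D(2)[OF w] val_in[OF w] by auto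
  qed
  then show ?thesis
    unfolding recognizable_iff[OF Vf] using C(1) k by blast
qed

lemma map_image_words: "map h ` words A = words (h ` A)"
proof -
  have "map h ` (lists A - {[]}) = map h ` lists A - {[]}" by auto
  then show ?thesis by (simp add: words_def lists_image set_diff_eq)
qed

lemma recognizable_image:
  assumes h: "inj_on h A" and L: "recognizable V A L"
  shows "recognizable V (h ` A) (map h ` L)"
proof -
  obtain S \<phi> where S: "L \<subseteq> words A" "S \<in> V" "\<phi> \<in> semigrp_hom (word_semigrp A) S"
    and eq: "L = {w \<in> words A. \<phi> w \<in> \<phi> ` L}" using L unfolding recognizable_def by blast
  let ?g = "map (inv_into A h)"
  have g: "?g (map h w) = w" if "w \<in> words A" for w
    using that h by (auto simp: words_def intro!: map_idI)
  have gw: "?g v \<in> words A \<and> map h (?g v) = v" if v: "v \<in> words (h ` A)" for v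
    using v g unfolding map_image_words[symmetric] by (auto simp del: map_map)
  have hom: "(\<lambda>v. \<phi> (?g v)) \<in> semigrp_hom (word_semigrp (h ` A)) S"
    using S(3) gw by (auto simp: semigrp_hom_def word_semigrp_def)
  have img: "(\<lambda>v. \<phi> (?g v)) ` map h ` L = \<phi> ` L"
    using S(1) g by (force simp: image_image)
  have "map h ` L = {v \<in> words (h ` A). \<phi> (?g v) \<in> \<phi> ` L}" (is "_ = ?X")
  proof
    show "map h ` L \<subseteq> ?X"
    proof
      fix v assume "v \<in> map h ` L"
      then obtain w where w: "w \<in> L" "v = map h w" "w \<in> words A" using S(1) by blast
      then have "v \<in> words (h ` A)" unfolding map_image_words[symmetric] by blast
      then show "v \<in> ?X" using g[OF w(3)] w by simp
    qed
    show "?X \<subseteq> map h ` L"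
    proof
      fix v assume "v \<in> ?X"
      then have v: "v \<in> words (h ` A)" "\<phi> (?g v) \<in> \<phi> ` L" by blast+
      then have "?g v \<in> L" using gw eq by blast
      then show "v \<in> map h ` L" using gw[OF v(1)] by (metis imageI)
    qed
  qed
  then have "map h ` L = {v \<in> words (h ` A). \<phi> (?g v) \<in> (\<lambda>v. \<phi> (?g v)) ` map h ` L}"
    unfolding img .
  moreover have "map h ` L \<subseteq> words (h ` A)" using S(1) unfolding map_image_words[symmetric] by blast
  ultimately show ?thesis unfolding recognizable_def
    by (intro conjI bexI[OF _ S(2)] bexI[OF _ hom])
qed

lemma map_inj_on_words:
  assumes h: "inj_on h A" and w: "set u \<subseteq> A" "set v \<subseteq> A"
  shows "map h u = map h v \<Longrightarrow> u = v"
  using inj_on_map_eq_map[of h u v] h w by (auto intro: inj_on_subset)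

lemma prefix_code_image:
  assumes h: "inj_on h A" and L: "prefix_code A L"
  shows "prefix_code (h ` A) (map h ` L)"
proof -
  have "map h y \<noteq> map h x @ map h w" if "x \<in> L" "y \<in> L" "w \<in> words A" for x y w
  proof
    assume "map h y = map h x @ map h w"
    then have "x @ w = y" using map_inj_on_words[OF h, of "x @ w" y] L that
      by (auto simp: prefix_code_def words_def)
    then show False using L that unfolding prefix_code_def by blast
  qed
  moreover have "map h ` L \<subseteq> lists (h ` A)"
    using L unfolding lists_image prefix_code_def by blast
  ultimately show ?thesis unfolding prefix_code_def map_image_words[symmetric] by auto
qed

lemma suffix_code_image:
  assumes h: "inj_on h A" and L: "suffix_code A L"
  shows "suffix_code (h ` A) (map h ` L)"
proof -
  have "map h y \<noteq> map h w @ map h x" if "x \<in> L" "y \<in> L" "w \<in> words A" for x y w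
  proof
    assume "map h y = map h w @ map h x"
    then have "w @ x = y" using map_inj_on_words[OF h, of "w @ x" y] L that
      by (auto simp: suffix_code_def words_def)
    then show False using L that unfolding suffix_code_def by blast
  qed
  moreover have "map h ` L \<subseteq> lists (h ` A)"
    using L unfolding lists_image suffix_code_def by blast
  ultimately show ?thesis unfolding suffix_code_def map_image_words[symmetric] by auto
qed

text \<open>The definition of closure under bideterministic product speaks of alphabets of natural numbers; all
  notions involved are invariant under renaming letters.\<close>

lemma bidet_product_recognizable:
  fixes A :: "'a set"
  assumes V: "bidet_closed V" and A: "finite A" "a \<in> A"
    and L: "recognizable V A L \<or> L = {[]}" and K: "recognizable V A K \<or> K = {[]}"
    and La: "prefix_code A {x @ [a] | x. x \<in> L}" and aK: "suffix_code A {a # y | y. y \<in> K}"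
  shows "recognizable V A {x @ [a] @ y | x y. x \<in> L \<and> y \<in> K}" (is "recognizable V A ?W")
proof -
  obtain h :: "'a \<Rightarrow> nat" where h: "inj_on h A"
    using finite_imp_inj_to_nat_seg[OF A(1)] by auto
  have La': "map h ` {x @ [a] | x. x \<in> L} = {x @ [h a] | x. x \<in> map h ` L}"
    and aK': "map h ` {a # y | y. y \<in> K} = {h a # y | y. y \<in> map h ` K}"
    unfolding Setcompr_eq_image by (simp_all add: image_image)
  have W': "map h ` ?W = {x @ [h a] @ y | x y. x \<in> map h ` L \<and> y \<in> map h ` K}"
  proof (intro equalityI subsetI)
    fix z assume "z \<in> {x @ [h a] @ y | x y. x \<in> map h ` L \<and> y \<in> map h ` K}"
    then obtain x y where "z = map h (x @ [a] @ y)" "x \<in> L" "y \<in> K" by auto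
    then show "z \<in> map h ` ?W" by blast
  next
    fix z assume "z \<in> map h ` ?W"
    then obtain x y where "z = map h x @ [h a] @ map h y" "x \<in> L" "y \<in> K" by auto
    then show "z \<in> {x @ [h a] @ y | x y. x \<in> map h ` L \<and> y \<in> map h ` K}" by blast
  qed
  have "recognizable V (h ` A) (map h ` L) \<or> map h ` L = {[]}"
    "recognizable V (h ` A) (map h ` K) \<or> map h ` K = {[]}"
    using L K recognizable_image[OF h] by auto
  then have W: "recognizable V (h ` A) (map h ` ?W)"
    using V[unfolded bidet_closed_def, rule_format, of "h ` A" "h a" "map h ` L" "map h ` K"]
      A prefix_code_image[OF h La] suffix_code_image[OF h aK] unfolding La' aK' W' by simp
  have "?W \<subseteq> lists A"
  proof
    fix z assume "z \<in> ?W"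
    then obtain x y where z: "z = x @ [a] @ y" "x \<in> L" "y \<in> K" by blast
    then have "x @ [a] \<in> lists A" "a # y \<in> lists A"
      using La aK unfolding prefix_code_def suffix_code_def by blast+
    then show "z \<in> lists A" using z by simp
  qed
  moreover have "map (inv_into A h) (map h z) = z" if "z \<in> lists A" for z
    using that h by (auto intro!: map_idI)
  ultimately have "map (inv_into A h) ` map h ` ?W = ?W"
    by (force simp: image_image subset_iff simp del: map_map)
  moreover have "inv_into A h ` h ` A = A" using h by force
  ultimately show ?thesis
    using recognizable_image[OF inj_on_inv_into[of "h ` A" h A] W] by simp
qed

section \<open>Finite approximation of pseudowords\<close>

abbreviation pwords1 :: "nat semigrp set \<Rightarrow> 'a set \<Rightarrow> 'a pseudoword option semigrp" where
  "pwords1 V A \<equiv> adj_id (Omega V A)"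

definition word_elem :: "nat semigrp set \<Rightarrow> 'a set \<Rightarrow> 'a list \<Rightarrow> 'a pseudoword option" where
  "word_elem V A w = (if w = [] then None else Some (pword V A w))"

text \<open>The sets \<open>F\<close> are finite sets of coordinates, so \<open>agree F\<close> are the basic entourages of the profinite
  uniformity, extended to the monoid with adjoined neutral element. Any nonempty \<open>F\<close> separates the neutral
  element from all others.\<close>

definition agree :: "'i set \<Rightarrow> ('i \<Rightarrow> 'c) option \<Rightarrow> ('i \<Rightarrow> 'c) option \<Rightarrow> bool" where
  "agree F x y \<longleftrightarrow> (\<forall>i\<in>F. map_option (\<lambda>f. f i) x = map_option (\<lambda>f. f i) y)"

lemma agree_refl [simp]: "agree F x x"
  and agree_sym: "agree F x y \<Longrightarrow> agree F y x"
  and agree_trans: "agree F x y \<Longrightarrow> agree F y z \<Longrightarrow> agree F x z"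
  and agree_mono: "agree G x y \<Longrightarrow> F \<subseteq> G \<Longrightarrow> agree F x y"
  by (auto simp: agree_def)

lemma adj_id_simps [simp]:
  "None \<cdot>\<^bsub>adj_id S\<^esub> y = y" "x \<cdot>\<^bsub>adj_id S\<^esub> None = x"
  "Some a \<cdot>\<^bsub>adj_id S\<^esub> Some b = Some (a \<cdot>\<^bsub>S\<^esub> b)"
  "None \<in> carrier (adj_id S)" "Some a \<in> carrier (adj_id S) \<longleftrightarrow> a \<in> carrier S"
  by (auto simp: adj_id_def split: option.split)

lemma adj_id_closed:
  "is_semigrp S \<Longrightarrow> x \<in> carrier (adj_id S) \<Longrightarrow> y \<in> carrier (adj_id S) \<Longrightarrow>
   x \<cdot>\<^bsub>adj_id S\<^esub> y \<in> carrier (adj_id S)"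
  by (cases x; cases y) (auto simp: is_semigrp_def)

lemma adj_id_assoc:
  "is_semigrp S \<Longrightarrow> x \<in> carrier (adj_id S) \<Longrightarrow> y \<in> carrier (adj_id S) \<Longrightarrow> z \<in> carrier (adj_id S) \<Longrightarrow>
   (x \<cdot>\<^bsub>adj_id S\<^esub> y) \<cdot>\<^bsub>adj_id S\<^esub> z = x \<cdot>\<^bsub>adj_id S\<^esub> (y \<cdot>\<^bsub>adj_id S\<^esub> z)"
  by (cases x; cases y; cases z) (auto simp: is_semigrp_def)

lemma adj_id_unit_irreducible: "x \<cdot>\<^bsub>adj_id S\<^esub> y = None \<Longrightarrow> x = None \<and> y = None"
  by (cases x; cases y) auto

lemma coord_mult:
  assumes "i \<in> pro_index V A"
  shows "map_option (\<lambda>f. f i) (x \<cdot>\<^bsub>pwords1 V A\<^esub> y) =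
    map_option (\<lambda>f. f i) x \<cdot>\<^bsub>adj_id (fst i)\<^esub> map_option (\<lambda>f. f i) y"
  using assms by (cases x; cases y; cases i) (auto simp: Omega_def)

lemma agree_mult:
  assumes "F \<subseteq> pro_index V A" "agree F x x'" "agree F y y'"
  shows "agree F (x \<cdot>\<^bsub>pwords1 V A\<^esub> y) (x' \<cdot>\<^bsub>pwords1 V A\<^esub> y')"
  using assms by (auto simp: agree_def coord_mult subset_iff)

lemma pwords1_eqI:
  assumes "x \<in> carrier (pwords1 V A)" "y \<in> carrier (pwords1 V A)" "pro_index V A \<noteq> {}"
    and agree: "\<And>i. i \<in> pro_index V A \<Longrightarrow> agree {i} x y"
  shows "x = y"
proof (cases "x = None \<or> y = None")
  case True
  then show ?thesis using assms(3) agree by (fastforce simp: agree_def)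
next
  case False
  then obtain f g where xy: "x = Some f" "y = Some g" by auto
  then have "f = g"
    using assms Omega_ext(1)[of _ V A] by (intro extensionalityI[of f _ g]) (auto simp: agree_def)
  then show ?thesis using xy by simp
qed

lemma pword_dense:
  assumes x: "x \<in> carrier (Omega V A)" and F: "finite F" "F \<subseteq> pro_index V A"
  shows "\<exists>w\<in>words A. \<forall>i\<in>F. pword V A w i = x i"
proof -
  let ?B = "\<lambda>i. if i \<in> F then {x i} else carrier (fst i)"
  let ?U = "PiE (pro_index V A) ?B"
  have xi: "x i \<in> carrier (fst i)" if "i \<in> pro_index V A" for i
    using Omega_ext(2)[OF x, of "fst i" "snd i"] that by simp
  have "x \<in> ?U" using Omega_ext(1)[OF x] xi by (auto simp: PiE_iff)
  moreover have "openin (pro_top V A) ?U"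
    unfolding pro_top_def openin_PiE_gen
  proof (intro disjI2 conjI ballI)
    show "finite {i \<in> pro_index V A. ?B i \<noteq> topspace (case i of (S, \<phi>) \<Rightarrow> discrete_topology (carrier S))}"
      by (rule finite_subset[OF _ F(1)]) (auto simp: case_prod_unfold)
  next
    fix i assume "i \<in> pro_index V A"
    then show "openin (case i of (S, \<phi>) \<Rightarrow> discrete_topology (carrier S)) (?B i)"
      using xi by (auto simp: case_prod_unfold)
  qed
  moreover have "x \<in> pro_top V A closure_of (pword V A ` words A)" using x by (simp add: Omega_def)
  ultimately obtain y where "y \<in> pword V A ` words A" "y \<in> ?U"
    unfolding in_closure_of by meson
  then show ?thesis using F(2) by (fastforce simp: PiE_iff)
qed

lemma word_elem_dense:
  assumes x: "x \<in> carrier (pwords1 V A)" and F: "finite F" "F \<subseteq> pro_index V A"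
  shows "\<exists>w\<in>lists A. agree F (word_elem V A w) x"
proof (cases x)
  case None
  then show ?thesis by (intro bexI[of _ "[]"]) (auto simp: word_elem_def)
next
  case (Some f)
  then obtain w where "w \<in> words A" "\<forall>i\<in>F. pword V A w i = f i" using pword_dense[OF _ F] x by auto
  then show ?thesis using Some by (intro bexI[of _ w]) (auto simp: word_elem_def agree_def words_def)
qed

text \<open>The adjoined neutral element is an isolated point. Either it satisfies all conditions, or it violates one at
  a coordinate \<open>j\<close>; in this case only proper pseudowords can satisfy finitely many conditions
  including the one at \<open>j\<close>, and compactness of the space of pseudowords applies.\<close>

lemma pwords1_compactness:
  assumes V: "V \<subseteq> fin_semigrps"
    and fin: "\<And>F. finite F \<Longrightarrow> F \<subseteq> pro_index V A \<Longrightarrow>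
      \<exists>t\<in>carrier (pwords1 V A). \<forall>i\<in>F. P i (map_option (\<lambda>f. f i) t)"
  shows "\<exists>t\<in>carrier (pwords1 V A). \<forall>i\<in>pro_index V A. P i (map_option (\<lambda>f. f i) t)"
proof (cases "\<forall>i\<in>pro_index V A. P i None")
  case True
  then show ?thesis by (intro bexI[of _ None]) auto
next
  case False
  then obtain j where j: "j \<in> pro_index V A" "\<not> P j None" by blast
  let ?C = "\<lambda>i. {t \<in> carrier (Omega V A). P i (Some (t i))}"
  have "closedin (Omega_top V A) (?C i)" if "i \<in> pro_index V A" for i
  proof -
    have "continuous_map (Omega_top V A) ((\<lambda>(S, \<phi>). discrete_topology (carrier S)) i) (\<lambda>x. x i)"
      unfolding Omega_top_def pro_top_def
      by (intro continuous_map_from_subtopology continuous_map_product_projection that)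
    then have c: "continuous_map (Omega_top V A) (discrete_topology (carrier (fst i))) (\<lambda>x. x i)"
      by (simp add: case_prod_unfold)
    have "closedin (Omega_top V A) {t \<in> topspace (Omega_top V A). t i \<in> {c \<in> carrier (fst i). P i (Some c)}}"
      by (rule closedin_continuous_map_preimage[OF c]) auto
    moreover have "{t \<in> topspace (Omega_top V A). t i \<in> {c \<in> carrier (fst i). P i (Some c)}} = ?C i"
      using Omega_ext(2)[of _ V A "fst i" "snd i"] that by auto
    ultimately show ?thesis by simp
  qed
  then have "\<forall>C\<in>?C ` pro_index V A. closedin (Omega_top V A) C" by blast
  moreover have "\<Inter>\<F> \<noteq> {}" if F: "finite \<F>" "\<F> \<subseteq> ?C ` pro_index V A" for \<F>
  proof -
    obtain F where F': "finite F" "F \<subseteq> pro_index V A" "\<F> = ?C ` F"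
      using finite_subset_image[OF F] by blast
    obtain t where t: "t \<in> carrier (pwords1 V A)" "\<forall>i\<in>insert j F. P i (map_option (\<lambda>f. f i) t)"
      using fin[of "insert j F"] F'(1,2) j(1) by blast
    then have "t \<noteq> None" using j(2) by (metis insertI1 option.simps(8))
    then obtain f where "t = Some f" by auto
    then have "f \<in> \<Inter>\<F>" using t unfolding F'(3) by simp
    then show ?thesis by blast
  qed
  ultimately have "\<Inter>(?C ` pro_index V A) \<noteq> {}"
    using compact_Omega(1)[OF V, of A, unfolded compact_space_fip, rule_format, of "?C ` pro_index V A"] by blast
  then obtain t where t: "\<And>i. i \<in> pro_index V A \<Longrightarrow> t \<in> ?C i" by blast
  then have "t \<in> carrier (Omega V A)" using j by blast
  then show ?thesis using t by (intro bexI[of _ "Some t"]) auto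
qed

text \<open>Solvability at every finite set of coordinates implies solvability. Two equations are solved
  simultaneously because a common part of two pseudowords is sought when a cut is located in a product;
  a single equation \<open>x = u t u'\<close> is the case in which both are the same.\<close>

lemma equations_by_compactness:
  fixes V :: "nat semigrp set" and A :: "'a set"
  defines "M \<equiv> pwords1 V A"
  assumes V: "V \<subseteq> fin_semigrps" and ne: "pro_index V A \<noteq> {}" and S: "is_semigrp (Omega V A)"
    and fin: "\<And>F. finite F \<Longrightarrow> F \<subseteq> pro_index V A \<Longrightarrow>
      \<exists>t\<in>carrier M. agree F x (u \<cdot>\<^bsub>M\<^esub> (t \<cdot>\<^bsub>M\<^esub> u')) \<and> agree F y (v \<cdot>\<^bsub>M\<^esub> (t \<cdot>\<^bsub>M\<^esub> v'))"
    and xy: "x \<in> carrier M" "y \<in> carrier M" "u \<in> carrier M" "u' \<in> carrier M"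
      "v \<in> carrier M" "v' \<in> carrier M"
  shows "\<exists>t\<in>carrier M. x = u \<cdot>\<^bsub>M\<^esub> (t \<cdot>\<^bsub>M\<^esub> u') \<and> y = v \<cdot>\<^bsub>M\<^esub> (t \<cdot>\<^bsub>M\<^esub> v')"
proof -
  let ?c = "\<lambda>i :: nat semigrp \<times> ('a \<Rightarrow> nat). map_option (\<lambda>f. f i)"
  let ?P = "\<lambda>i s. ?c i x = ?c i u \<cdot>\<^bsub>adj_id (fst i)\<^esub> (s \<cdot>\<^bsub>adj_id (fst i)\<^esub> ?c i u') \<and>
      ?c i y = ?c i v \<cdot>\<^bsub>adj_id (fst i)\<^esub> (s \<cdot>\<^bsub>adj_id (fst i)\<^esub> ?c i v')"
  have *: "agree F x (u \<cdot>\<^bsub>M\<^esub> (t \<cdot>\<^bsub>M\<^esub> u')) \<and> agree F y (v \<cdot>\<^bsub>M\<^esub> (t \<cdot>\<^bsub>M\<^esub> v')) \<longleftrightarrow> (\<forall>i\<in>F. ?P i (?c i t))"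
    if "F \<subseteq> pro_index V A" for F t
    using that by (auto simp: agree_def coord_mult subset_iff M_def)
  have "\<exists>t\<in>carrier (pwords1 V A). \<forall>i\<in>pro_index V A. ?P i (?c i t)"
  proof (rule pwords1_compactness[OF V])
    fix F assume "finite F" "F \<subseteq> pro_index V A"
    then show "\<exists>t\<in>carrier (pwords1 V A). \<forall>i\<in>F. ?P i (?c i t)"
      using fin[of F] *[of F] by (simp add: M_def)
  qed
  then obtain t where t: "t \<in> carrier M" "\<forall>i\<in>pro_index V A. ?P i (?c i t)" unfolding M_def ..
  have "agree {i} x (u \<cdot>\<^bsub>M\<^esub> (t \<cdot>\<^bsub>M\<^esub> u')) \<and> agree {i} y (v \<cdot>\<^bsub>M\<^esub> (t \<cdot>\<^bsub>M\<^esub> v'))"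
    if "i \<in> pro_index V A" for i
    using *[of "{i}" t] t(2) that by blast
  then have "x = u \<cdot>\<^bsub>M\<^esub> (t \<cdot>\<^bsub>M\<^esub> u')" "y = v \<cdot>\<^bsub>M\<^esub> (t \<cdot>\<^bsub>M\<^esub> v')"
    using xy t(1) unfolding M_def by (auto intro!: pwords1_eqI[OF _ _ ne] adj_id_closed[OF S])
  then show ?thesis using t(1) by blast
qed

section \<open>Good cuts and bideterministic products\<close>

lemma prefix_code_unique:
  assumes L: "prefix_code A L" "u \<in> L" "u' \<in> L" and v: "v \<in> lists A" "v' \<in> lists A"
    and eq: "u @ v = u' @ v'"
  shows "u = u'"
proof -
  obtain w where w: "u = u' @ w \<and> w @ v = v' \<or> u @ w = u' \<and> v = w @ v'"
    using eq unfolding append_eq_append_conv2 by blast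
  then have "w \<in> lists A" using v by auto
  then have "w = []" using w L unfolding prefix_code_def words_def by blast
  then show ?thesis using w by simp
qed

lemma suffix_code_unique:
  assumes L: "suffix_code A L" "v \<in> L" "v' \<in> L" and u: "u \<in> lists A" "u' \<in> lists A"
    and eq: "u @ v = u' @ v'"
  shows "v = v'"
proof -
  obtain w where w: "u = u' @ w \<and> w @ v = v' \<or> u @ w = u' \<and> v = w @ v'"
    using eq unfolding append_eq_append_conv2 by blast
  then have "w \<in> lists A" using u by auto
  then have "w = []" using w L unfolding suffix_code_def words_def by blast
  then show ?thesis using w by simp
qed

locale bidet_alphabet =
  fixes V :: "nat semigrp set" and A :: "'a set"
  assumes pseudovariety: "pseudovariety V" and bidet: "bidet_closed V"
    and finite_A: "finite A" and A_ne: "A \<noteq> {}"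
begin

abbreviation "I \<equiv> pro_index V A"
abbreviation "M \<equiv> pwords1 V A"
abbreviation "wd \<equiv> word_elem V A"
abbreviation mult (infixr "\<odot>" 70) where "x \<odot> y \<equiv> x \<cdot>\<^bsub>M\<^esub> y"
abbreviation "lt \<equiv> (\<lambda>a. Some (pword V A [a]))"

lemma V_fin: "V \<subseteq> fin_semigrps"
  using pseudovariety by (simp add: pseudovariety_def)

lemma Omega_is_semigrp: "is_semigrp (Omega V A)"
  by (rule Omega_semigrp[OF V_fin A_ne])

lemmas M_closed = adj_id_closed[OF Omega_is_semigrp]
lemmas M_assoc = adj_id_assoc[OF Omega_is_semigrp]

lemma I_ne: "I \<noteq> {}"
proof -
  let ?T = "\<lparr>carrier = {0::nat}, smult = (\<lambda>x y. 0)\<rparr>"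
  have "?T \<in> fin_semigrps" by (simp add: fin_semigrps_def is_semigrp_def)
  moreover have "card (carrier ?T) = 1" by simp
  ultimately have "?T \<in> V" using pseudovariety unfolding pseudovariety_def by blast
  then have "(?T, \<lambda>a\<in>A. 0) \<in> I" by (auto simp: pro_index_def)
  then show ?thesis by blast
qed

lemma wd_in: "w \<in> lists A \<Longrightarrow> wd w \<in> carrier M"
  using pword_in_Omega[OF V_fin, of w A] by (auto simp: word_elem_def words_def)

lemma lt_in: "a \<in> A \<Longrightarrow> lt a \<in> carrier M"
  using pword_in_Omega[OF V_fin, of "[a]" A] by (simp add: words_def)

lemma wd_append: "u \<in> lists A \<Longrightarrow> w \<in> lists A \<Longrightarrow> wd (u @ w) = wd u \<odot> wd w"
  using pword_append[OF V_fin, of u A w] by (auto simp: word_elem_def words_def)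

lemma wd_letter: "wd [a] = lt a"
  by (simp add: word_elem_def)

lemma wd_cut: "x \<in> lists A \<Longrightarrow> y \<in> lists A \<Longrightarrow> a \<in> A \<Longrightarrow> wd (x @ [a] @ y) = wd x \<odot> lt a \<odot> wd y"
  by (subst wd_append, simp_all, subst wd_append[of "[a]", simplified], simp_all add: wd_letter)

lemma recognizable_coordinates:
  assumes "finite F" "F \<subseteq> I"
  shows "recognizable V A {w \<in> words A. \<forall>i\<in>F. pword V A w i = g i}"
  using assms
proof (induction F)
  case empty
  show ?case using I_ne by (auto simp: recognizable_iff[OF V_fin])
next
  case (insert i F)
  have "recognizable V A {w \<in> words A. pword V A w i = g i}"
    unfolding recognizable_iff[OF V_fin]
    using insert by (intro conjI bexI[of _ i] exI[of _ "{g i}"]) auto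
  then have "recognizable V A ({w \<in> words A. pword V A w i = g i} \<inter>
      {w \<in> words A. \<forall>i\<in>F. pword V A w i = g i})"
    using insert by (intro recognizable_Int[OF pseudovariety]) auto
  moreover have "{w \<in> words A. pword V A w i = g i} \<inter> {w \<in> words A. \<forall>i\<in>F. pword V A w i = g i} =
      {w \<in> words A. \<forall>i\<in>insert i F. pword V A w i = g i}" by auto
  ultimately show ?case by simp
qed

definition near :: "(nat semigrp \<times> ('a \<Rightarrow> nat)) set \<Rightarrow> 'a pseudoword option \<Rightarrow> 'a list set" where
  "near F x = {w \<in> lists A. agree F (wd w) x}"

lemma near_recognizable:
  assumes "finite F" "F \<subseteq> I" "F \<noteq> {}"
  shows "recognizable V A (near F x) \<or> near F x = {[]}"
proof (cases x)
  case None
  then have "near F x = {[]}" using assms(3) by (auto simp: near_def agree_def word_elem_def)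
  then show ?thesis by simp
next
  case (Some f)
  then have "near F x = {w \<in> words A. \<forall>i\<in>F. pword V A w i = f i}"
    using assms(3) by (auto simp: near_def agree_def word_elem_def words_def)
  then show ?thesis using recognizable_coordinates[OF assms(1,2), of f] by simp
qed

lemma near_ne: "x \<in> carrier M \<Longrightarrow> finite F \<Longrightarrow> F \<subseteq> I \<Longrightarrow> near F x \<noteq> {}"
  using word_elem_dense[of x V A F] by (auto simp: near_def)

lemma agree_cong:
  "F \<subseteq> I \<Longrightarrow> agree F x x' \<Longrightarrow> agree F y y' \<Longrightarrow> agree F (x \<odot> y) (x' \<odot> y')"
  by (rule agree_mult)

text \<open>If \<open>x a\<close> returned to \<open>x\<close> in every finite quotient, it would do so among pseudowords by compactness. Hence
  a strict inequality is visible at finitely many coordinates.\<close>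

lemma falls_R_witness:
  assumes x: "x \<in> carrier M" and a: "a \<in> A" and f: "falls_R M x (lt a)"
  shows "\<exists>F. finite F \<and> F \<subseteq> I \<and> (\<forall>z\<in>carrier M. \<not> agree F x (x \<odot> lt a \<odot> z))"
proof (rule ccontr)
  assume no: "\<not> ?thesis"
  have "\<exists>z\<in>carrier M. x = (x \<odot> lt a) \<odot> (z \<odot> None) \<and> x = (x \<odot> lt a) \<odot> (z \<odot> None)"
  proof (rule equations_by_compactness[OF V_fin I_ne Omega_is_semigrp])
    fix F assume "finite F" "F \<subseteq> I"
    then obtain z where "z \<in> carrier M" "agree F x (x \<odot> lt a \<odot> z)" using no by blast
    then show "\<exists>z\<in>carrier M. agree F x ((x \<odot> lt a) \<odot> z \<odot> None) \<and> agree F x ((x \<odot> lt a) \<odot> z \<odot> None)"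
      using M_assoc[OF x lt_in[OF a]] by auto
  qed (use x lt_in[OF a] M_closed in auto)
  then show False using f unfolding falls_R_def by auto
qed

lemma falls_L_witness:
  assumes x: "x \<in> carrier M" and a: "a \<in> A" and f: "falls_L M (lt a) x"
  shows "\<exists>F. finite F \<and> F \<subseteq> I \<and> (\<forall>z\<in>carrier M. \<not> agree F x (z \<odot> lt a \<odot> x))"
proof (rule ccontr)
  assume no: "\<not> ?thesis"
  have "\<exists>z\<in>carrier M. x = None \<odot> (z \<odot> (lt a \<odot> x)) \<and> x = None \<odot> (z \<odot> (lt a \<odot> x))"
  proof (rule equations_by_compactness[OF V_fin I_ne Omega_is_semigrp])
    fix F assume "finite F" "F \<subseteq> I"
    then obtain z where "z \<in> carrier M" "agree F x (z \<odot> lt a \<odot> x)" using no by blast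
    then show "\<exists>z\<in>carrier M. agree F x (None \<odot> z \<odot> lt a \<odot> x) \<and> agree F x (None \<odot> z \<odot> lt a \<odot> x)"
      by auto
  qed (use x lt_in[OF a] M_closed in auto)
  then show False using f M_assoc[OF _ lt_in[OF a] x] unfolding falls_L_def by auto
qed

text \<open>If \<open>w a\<close> is a proper prefix of \<open>w' a\<close>, then \<open>w' = w a t\<close>; were both \<open>w\<close> and \<open>w'\<close> near \<open>x\<close>,
  this would make \<open>x a\<close> return to \<open>x\<close> at the coordinates in \<open>F\<close>.\<close>

lemma prefix_code_near:
  assumes x: "x \<in> carrier M" and a: "a \<in> A" and F: "F \<subseteq> I"
    and f: "\<forall>z\<in>carrier M. \<not> agree F x (x \<odot> lt a \<odot> z)"
  shows "prefix_code A {w @ [a] | w. w \<in> near F x}"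
proof -
  have False if w: "w \<in> near F x" "w' \<in> near F x" and v: "v \<in> words A" "(w @ [a]) @ v = w' @ [a]" for w w' v
  proof -
    obtain t b where t: "v = t @ [b]" using v(1) by (cases v rule: rev_cases) (auto simp: words_def)
    then have v': "t \<in> lists A" using v(1) by (auto simp: words_def)
    have "w' = w @ [a] @ t" using v(2) t by simp
    then have "wd w' = wd w \<odot> lt a \<odot> wd t" using wd_cut[of w t a] w v' a by (simp add: near_def)
    moreover have "agree F (wd w \<odot> lt a \<odot> wd t) (x \<odot> lt a \<odot> wd t)"
      using w(1) by (intro agree_cong[OF F]) (auto simp: near_def)
    moreover have "agree F x (wd w')" using w(2) agree_sym[of F "wd w'" x] by (simp add: near_def)
    ultimately show False
      using f[rule_format, OF wd_in[OF v']] agree_trans[of F x "wd w'"] by simp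
  qed
  moreover have "{w @ [a] | w. w \<in> near F x} \<subseteq> lists A" using a by (auto simp: near_def)
  ultimately show ?thesis unfolding prefix_code_def by blast
qed

lemma suffix_code_near:
  assumes x: "x \<in> carrier M" and a: "a \<in> A" and F: "F \<subseteq> I"
    and f: "\<forall>z\<in>carrier M. \<not> agree F x (z \<odot> lt a \<odot> x)"
  shows "suffix_code A {a # w | w. w \<in> near F x}"
proof -
  have False if w: "w \<in> near F x" "w' \<in> near F x" and v: "v \<in> words A" "v @ a # w = a # w'" for w w' v
  proof -
    have v': "tl v \<in> lists A" using v(1) by (auto simp: words_def dest: list.set_sel(2))
    have "w' = tl v @ [a] @ w" using v by (cases v) (auto simp: words_def)
    then have "wd w' = wd (tl v) \<odot> lt a \<odot> wd w" using wd_cut[of "tl v" w a] w v' a by (simp add: near_def)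
    moreover have "agree F (wd (tl v) \<odot> lt a \<odot> wd w) (wd (tl v) \<odot> lt a \<odot> x)"
      using w(1) by (intro agree_cong[OF F]) (auto simp: near_def)
    moreover have "agree F x (wd w')" using w(2) agree_sym[of F "wd w'" x] by (simp add: near_def)
    ultimately show False
      using f[rule_format, OF wd_in[OF v']] agree_trans[of F x "wd w'"] by simp
  qed
  moreover have "{a # w | w. w \<in> near F x} \<subseteq> lists A" using a by (auto simp: near_def)
  ultimately show ?thesis unfolding suffix_code_def by blast
qed

text \<open>This is where closure under bideterministic product enters. At a good cut \<open>x a y\<close>, the words
  near \<open>x\<close> and those near \<open>y\<close> form languages \<open>L\<close> and \<open>K\<close> such that \<open>L a\<close> is a prefix code and
  \<open>a K\<close> is a suffix code. So \<open>L a K\<close> is recognizable, which means that it contains all words near \<open>x a y\<close>; and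
  since a word has at most one factorization in \<open>L a K\<close>, knowing one side of the cut determines the other.\<close>

lemma good_cut_neighbourhood:
  assumes x: "x \<in> carrier M" and y: "y \<in> carrier M" and a: "a \<in> A"
    and f: "falls_R M x (lt a)" "falls_L M (lt a) y" and F: "finite F" "F \<subseteq> I"
  obtains G where "finite G" "F \<subseteq> G" "G \<subseteq> I"
    and "\<And>w. w \<in> near G (x \<odot> lt a \<odot> y) \<Longrightarrow> \<exists>u v. w = u @ [a] @ v \<and> u \<in> near F x \<and> v \<in> near F y"
    and "\<And>u v. \<lbrakk>u @ [a] @ v \<in> near G (x \<odot> lt a \<odot> y); u \<in> near G x\<rbrakk> \<Longrightarrow> v \<in> near F y"
    and "\<And>u v. \<lbrakk>u @ [a] @ v \<in> near G (x \<odot> lt a \<odot> y); v \<in> near G y\<rbrakk> \<Longrightarrow> u \<in> near F x"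
proof -
  obtain F1 where F1: "finite F1" "F1 \<subseteq> I" "\<forall>z\<in>carrier M. \<not> agree F1 x (x \<odot> lt a \<odot> z)"
    using falls_R_witness[OF x a f(1)] by blast
  obtain F2 where F2: "finite F2" "F2 \<subseteq> I" "\<forall>z\<in>carrier M. \<not> agree F2 y (z \<odot> lt a \<odot> y)"
    using falls_L_witness[OF y a f(2)] by blast
  define H where "H = F \<union> F1 \<union> F2"
  \<comment> \<open>If \<open>H\<close> were empty, then all words, the empty one included, would be near \<open>x\<close>.\<close>
  have "F1 \<noteq> {}" using F1(3)[rule_format, OF adj_id_simps(4)] by (auto simp: agree_def)
  then have H: "finite H" "H \<subseteq> I" "H \<noteq> {}" "F \<subseteq> H" using F F1 F2 by (auto simp: H_def)
  have pre: "prefix_code A {w @ [a] | w. w \<in> near H x}"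
    using F1(3) agree_mono[of H _ _ F1] by (intro prefix_code_near[OF x a H(2)]) (auto simp: H_def)
  have suf: "suffix_code A {a # w | w. w \<in> near H y}"
    using F2(3) agree_mono[of H _ _ F2] by (intro suffix_code_near[OF y a H(2)]) (auto simp: H_def)
  define W where "W = {u @ [a] @ v | u v. u \<in> near H x \<and> v \<in> near H y}"
  have "recognizable V A W" unfolding W_def
    using bidet_product_recognizable[OF bidet finite_A a near_recognizable[OF H(1-3)]
      near_recognizable[OF H(1-3)] pre suf] .
  then obtain i C where i: "i \<in> I" and C: "W \<subseteq> words A" "\<forall>w\<in>words A. w \<in> W \<longleftrightarrow> pword V A w i \<in> C"
    unfolding recognizable_iff[OF V_fin] by blast
  \<comment> \<open>Adding the coordinate that recognizes \<open>L a K\<close> turns this language into a neighbourhood.\<close>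
  define G where "G = insert i H"
  have G: "finite G" "G \<subseteq> I" "H \<subseteq> G" using H i by (auto simp: G_def)
  have sub: "near H z \<subseteq> near F z" "near G z \<subseteq> near H z" for z
    using agree_mono[OF _ H(4)] agree_mono[OF _ G(3)] by (auto simp: near_def)
  have lists: "near G z \<subseteq> lists A" for G z by (auto simp: near_def)
  have in_W: "w \<in> W" if w: "w \<in> near G (x \<odot> lt a \<odot> y)" for w
  proof -
    obtain u where u: "u \<in> near G x" using near_ne[OF x G(1,2)] by blast
    obtain v where v: "v \<in> near G y" using near_ne[OF y G(1,2)] by blast
    note uv = u v
    have inW: "u @ [a] @ v \<in> W" using subsetD[OF sub(2) u] subsetD[OF sub(2) v] unfolding W_def by blast
    then have Cu: "pword V A (u @ [a] @ v) i \<in> C"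
      using C(2) subsetD[OF C(1) inW] by blast
    have "agree G (wd (u @ [a] @ v)) (x \<odot> lt a \<odot> y)"
      using uv wd_cut[of u v a] a agree_cong[OF G(2)] by (simp add: near_def)
    moreover have "agree G (wd w) (x \<odot> lt a \<odot> y)" using w by (simp add: near_def)
    ultimately have "agree G (wd w) (wd (u @ [a] @ v))" by (metis agree_sym agree_trans)
    then have "map_option (\<lambda>f. f i) (wd w) = Some (pword V A (u @ [a] @ v) i)"
      by (auto simp: agree_def G_def word_elem_def)
    then have "w \<noteq> []" "pword V A w i = pword V A (u @ [a] @ v) i"
      by (auto simp: word_elem_def split: if_splits)
    moreover have "w \<in> words A" using calculation w by (simp add: near_def words_def)
    ultimately show ?thesis using C(2) Cu by simp
  qed
  show thesis
  proof (rule that[of G])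
    show "\<exists>u v. w = u @ [a] @ v \<and> u \<in> near F x \<and> v \<in> near F y"
      if "w \<in> near G (x \<odot> lt a \<odot> y)" for w
      using in_W[OF that] sub unfolding W_def by blast
  next
    fix u v assume w: "u @ [a] @ v \<in> near G (x \<odot> lt a \<odot> y)" and u: "u \<in> near G x"
    obtain u' v' where eq: "u @ [a] @ v = u' @ [a] @ v'" "u' \<in> near H x" "v' \<in> near H y" using in_W[OF w] unfolding W_def by blast
    have v: "v \<in> lists A" "v' \<in> lists A"
      using subsetD[OF lists w] subsetD[OF lists eq(3)] by simp_all
    have "u @ [a] \<in> {w @ [a] | w. w \<in> near H x}" "u' @ [a] \<in> {w @ [a] | w. w \<in> near H x}"
      using subsetD[OF sub(2) u] eq(2) by blast+
    from prefix_code_unique[OF pre this v] have "v = v'" using eq(1) by simp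
    then show "v \<in> near F y" using subsetD[OF sub(1) eq(3)] by simp
  next
    fix u v assume w: "u @ [a] @ v \<in> near G (x \<odot> lt a \<odot> y)" and v: "v \<in> near G y"
    obtain u' v' where eq: "u @ [a] @ v = u' @ [a] @ v'" "u' \<in> near H x" "v' \<in> near H y" using in_W[OF w] unfolding W_def by blast
    have u: "u \<in> lists A" "u' \<in> lists A"
      using subsetD[OF lists w] subsetD[OF lists eq(2)] by simp_all
    have "a # v \<in> {a # w | w. w \<in> near H y}" "a # v' \<in> {a # w | w. w \<in> near H y}"
      using subsetD[OF sub(2) v] eq(3) by blast+
    from suffix_code_unique[OF suf this u] have "u = u'" using eq(1) by simp
    then show "u \<in> near F x" using subsetD[OF sub(1) eq(2)] by simp
  qed (use G H subset_trans[OF H(4) G(3)] in \<open>simp_all only:\<close>)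
qed

lemma near_wd: "w \<in> near F x \<Longrightarrow> agree F x (wd w)" "w \<in> near F x \<Longrightarrow> w \<in> lists A"
  by (simp_all add: near_def agree_sym)

lemma near_append:
  assumes "F \<subseteq> I" "u \<in> near F x" "v \<in> near F y"
  shows "u @ v \<in> near F (x \<odot> y)"
  using assms wd_append[of u v] agree_cong[OF assms(1)] by (simp add: near_def)

lemma near_letter: "a \<in> A \<Longrightarrow> [a] \<in> near F (lt a)"
  by (simp add: near_def wd_letter)

text \<open>Approximate \<open>x'\<close> and \<open>y'\<close> by words \<open>u\<close> and \<open>v\<close>. The word \<open>u v\<close> lies near \<open>x a y\<close>, so it has a factorization
  close to this cut, whose letter \<open>a\<close> falls into \<open>u\<close> or into \<open>v\<close>. One of the alternatives holds at all
  finite sets of coordinates, because a set refuting the first and a set refuting the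
  second have a union refuting both. Compactness then gives the missing middle part.\<close>

lemma good_cut_split:
  assumes x: "x \<in> carrier M" and y: "y \<in> carrier M" and x': "x' \<in> carrier M" and y': "y' \<in> carrier M"
    and a: "a \<in> A" and f: "falls_R M x (lt a)" "falls_L M (lt a) y" and eq: "x' \<odot> y' = x \<odot> lt a \<odot> y"
  shows "(\<exists>t\<in>carrier M. x' = x \<odot> lt a \<odot> t \<and> y = t \<odot> y') \<or>
    (\<exists>s\<in>carrier M. x = x' \<odot> s \<and> y' = s \<odot> lt a \<odot> y)"
proof -
  define P where "P = (\<lambda>F t. agree F x' ((x \<odot> lt a) \<odot> t \<odot> None) \<and> agree F y (None \<odot> t \<odot> y'))"
  define Q where "Q = (\<lambda>F s. agree F x (x' \<odot> s \<odot> None) \<and> agree F y' (None \<odot> s \<odot> lt a \<odot> y))"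
  have step: "(\<exists>t\<in>carrier M. P F t) \<or> (\<exists>s\<in>carrier M. Q F s)" if F: "finite F" "F \<subseteq> I" for F
  proof -
    obtain G where G: "finite G" "F \<subseteq> G" "G \<subseteq> I"
      and cut: "\<And>w. w \<in> near G (x \<odot> lt a \<odot> y) \<Longrightarrow> \<exists>u v. w = u @ [a] @ v \<and> u \<in> near F x \<and> v \<in> near F y"
      using good_cut_neighbourhood[OF x y a f F] by metis
    obtain u where u: "u \<in> near G x'" using near_ne[OF x' G(1,3)] by blast
    obtain v where v: "v \<in> near G y'" using near_ne[OF y' G(1,3)] by blast
    have uv: "agree F x' (wd u)" "agree F y' (wd v)" using near_wd u v agree_mono G(2) by blast+
    obtain p q where pq: "u @ v = p @ [a] @ q" "p \<in> near F x" "q \<in> near F y"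
      using cut[of "u @ v"] near_append[OF G(3) u v] unfolding eq by blast
    have xy: "agree F (wd p) x" "agree F y (wd q)" using pq near_wd agree_sym by blast+
    have A: "u \<in> lists A" "v \<in> lists A" "p \<in> lists A" "q \<in> lists A" using u v pq near_wd by blast+
    obtain r where r: "u = p @ r \<and> r @ v = [a] @ q \<or> u @ r = p \<and> v = r @ [a] @ q"
      using pq(1) unfolding append_eq_append_conv2 by blast
    consider t where "u = p @ [a] @ t" "q = t @ v" | s where "p = u @ s" "v = s @ [a] @ q"
      using r by (cases r) auto
    then show ?thesis
    proof cases
      case 1
      then have t: "t \<in> lists A" using A by simp
      have "wd u = wd p \<odot> lt a \<odot> wd t" "wd q = wd t \<odot> wd v"
        using 1 wd_cut[of p t a] wd_append[of t v] A t a by simp_all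
      then have "agree F x' (x \<odot> lt a \<odot> wd t)" "agree F y (wd t \<odot> y')"
        using agree_trans[OF uv(1)] agree_trans[OF xy(2)] agree_cong[OF F(2)] xy(1) agree_sym[OF uv(2)] by auto
      then have "P F (wd t)" using M_assoc[OF x lt_in[OF a] wd_in[OF t]] by (simp add: P_def)
      then show ?thesis using wd_in[OF t] by blast
    next
      case 2
      then have s: "s \<in> lists A" using A by simp
      have "wd p = wd u \<odot> wd s" "wd v = wd s \<odot> lt a \<odot> wd q"
        using 2 wd_cut[of s q a] wd_append[of u s] A s a by simp_all
      then have "agree F x (x' \<odot> wd s)" "agree F y' (wd s \<odot> lt a \<odot> y)"
        using agree_trans[OF uv(2)] agree_trans[OF agree_sym[OF xy(1)]] agree_cong[OF F(2)]
          agree_sym[OF uv(1)] agree_sym[OF xy(2)] by auto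
      then have "Q F (wd s)" by (simp add: Q_def)
      then show ?thesis using wd_in[OF s] by blast
    qed
  qed
  show ?thesis
  proof (cases "\<forall>F. finite F \<and> F \<subseteq> I \<longrightarrow> (\<exists>t\<in>carrier M. P F t)")
    case True
    have "\<exists>t\<in>carrier M. x' = (x \<odot> lt a) \<odot> t \<odot> None \<and> y = None \<odot> t \<odot> y'"
      by (rule equations_by_compactness[OF V_fin I_ne Omega_is_semigrp])
        (use True x y x' y' a lt_in M_closed in \<open>auto simp: P_def\<close>)
    then show ?thesis using M_assoc[OF x lt_in[OF a]] by auto
  next
    case False
    then obtain H where H: "finite H" "H \<subseteq> I" "\<forall>t\<in>carrier M. \<not> P H t" by blast
    have "\<exists>s\<in>carrier M. Q F s" if F: "finite F" "F \<subseteq> I" for F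
    proof -
      have "\<not> P (F \<union> H) t" if "t \<in> carrier M" for t
        using H(3) that agree_mono[of "F \<union> H" _ _ H] by (auto simp: P_def)
      then obtain s where "s \<in> carrier M" "Q (F \<union> H) s" using step[of "F \<union> H"] F H by auto
      then show ?thesis using agree_mono[of "F \<union> H" _ _ F] by (auto simp: Q_def)
    qed
    then have "\<exists>s\<in>carrier M. x = x' \<odot> s \<odot> None \<and> y' = None \<odot> s \<odot> lt a \<odot> y"
      unfolding Q_def
      by (intro equations_by_compactness[OF V_fin I_ne Omega_is_semigrp])
        (use x y x' y' a lt_in M_closed in auto)
    then show ?thesis by auto
  qed
qed

text \<open>Approximate \<open>x\<close> and \<open>y'\<close> by words \<open>u\<close> and \<open>v\<close>. Then \<open>u a v\<close> is near \<open>x a y\<close>, so \<open>v\<close> is near \<open>y\<close> too.\<close>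

lemma good_cut_cancel_left:
  assumes x: "x \<in> carrier M" and y: "y \<in> carrier M" and y': "y' \<in> carrier M"
    and a: "a \<in> A" and f: "falls_R M x (lt a)" "falls_L M (lt a) y" and eq: "x \<odot> lt a \<odot> y = x \<odot> lt a \<odot> y'"
  shows "y = y'"
proof (rule pwords1_eqI[OF y y' I_ne])
  fix i assume "i \<in> I"
  then have i: "finite {i}" "{i} \<subseteq> I" by simp_all
  obtain G where G: "finite G" "{i} \<subseteq> G" "G \<subseteq> I"
    and cut: "\<And>u v. \<lbrakk>u @ [a] @ v \<in> near G (x \<odot> lt a \<odot> y); u \<in> near G x\<rbrakk> \<Longrightarrow> v \<in> near {i} y"
    using good_cut_neighbourhood[OF x y a f i] by metis
  obtain u where u: "u \<in> near G x" using near_ne[OF x G(1,3)] by blast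
  obtain v where v: "v \<in> near G y'" using near_ne[OF y' G(1,3)] by blast
  have "u @ [a] @ v \<in> near G (x \<odot> lt a \<odot> y)"
    unfolding eq by (intro near_append[OF G(3)] near_letter u v a)
  then have "agree {i} y (wd v)" using cut u near_wd by blast
  moreover have "agree {i} (wd v) y'"
    using agree_mono[OF near_wd(1)[OF v] G(2)] by (rule agree_sym)
  ultimately show "agree {i} y y'" by (rule agree_trans)
qed

lemma good_cut_cancel_right:
  assumes x: "x \<in> carrier M" and x': "x' \<in> carrier M" and y: "y \<in> carrier M"
    and a: "a \<in> A" and f: "falls_R M x (lt a)" "falls_L M (lt a) y" and eq: "x \<odot> lt a \<odot> y = x' \<odot> lt a \<odot> y"
  shows "x = x'"
proof (rule pwords1_eqI[OF x x' I_ne])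
  fix i assume "i \<in> I"
  then have i: "finite {i}" "{i} \<subseteq> I" by simp_all
  obtain G where G: "finite G" "{i} \<subseteq> G" "G \<subseteq> I"
    and cut: "\<And>u v. \<lbrakk>u @ [a] @ v \<in> near G (x \<odot> lt a \<odot> y); v \<in> near G y\<rbrakk> \<Longrightarrow> u \<in> near {i} x"
    using good_cut_neighbourhood[OF x y a f i] by metis
  obtain u where u: "u \<in> near G x'" using near_ne[OF x' G(1,3)] by blast
  obtain v where v: "v \<in> near G y" using near_ne[OF y G(1,3)] by blast
  have "u @ [a] @ v \<in> near G (x \<odot> lt a \<odot> y)"
    unfolding eq by (intro near_append[OF G(3)] near_letter u v a)
  then have "agree {i} x (wd u)" using cut v near_wd by blast
  moreover have "agree {i} (wd u) x'"
    using agree_mono[OF near_wd(1)[OF u] G(2)] by (rule agree_sym)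
  ultimately show "agree {i} x x'" by (rule agree_trans)
qed

lemma letters_fall:
  assumes "a \<in> A" shows "falls_R M None (lt a)" "falls_L M (lt a) None"
  unfolding falls_R_def falls_L_def
  using adj_id_unit_irreducible[of "Omega V A" "lt a"] adj_id_unit_irreducible[of "Omega V A" _ "lt a"]
  by (auto simp del: not_None_eq)

lemma letters_distinct:
  assumes a: "a \<in> A" and b: "b \<in> A" and eq: "lt a = lt b"
  shows "a = b"
proof -
  obtain G where "G \<subseteq> I"
    and "\<And>w. w \<in> near G (None \<odot> lt a \<odot> None) \<Longrightarrow> \<exists>u v. w = u @ [a] @ v \<and> u \<in> near {} None \<and> v \<in> near {} None"
    using good_cut_neighbourhood[OF adj_id_simps(4) adj_id_simps(4) a letters_fall[OF a] finite.emptyI empty_subsetI]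
    by metis
  moreover have "[b] \<in> near G (None \<odot> lt a \<odot> None)" using near_letter[OF b, of G] eq by simp
  ultimately have "\<exists>u v. [b] = u @ [a] @ v" by blast
  then show ?thesis by (auto simp: Cons_eq_append_conv)
qed

sublocale letter_cuts M None A lt
proof (standard, goal_cases)
  case (1 x y) then show ?case by (rule M_closed)
next
  case (2 x y z) then show ?case by (rule M_assoc)
next
  case (6 x y) then show ?case by (intro adj_id_unit_irreducible)
next
  case (7 a) then show ?case by (rule lt_in)
next
  case (9 a b) then show ?case by (intro letters_distinct)
next
  case (10 x y x' y' a) then show ?case by (rule good_cut_split)
next
  case (11 x y y' a) then show ?case by (rule good_cut_cancel_left)
next
  case (12 x x' y a) then show ?case by (rule good_cut_cancel_right)
qed simp_all

end

section \<open>Organized factorizations as sequences of letters and blocks\<close>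

fun tokens :: "(nat \<Rightarrow> 'a list) \<Rightarrow> (nat \<Rightarrow> 'm) \<Rightarrow> nat \<Rightarrow> ('a, 'm) token list" where
  "tokens u p 0 = map Letter (u 0)"
| "tokens u p (Suc k) = tokens u p k @ Block (p (Suc k)) # map Letter (u (Suc k))"

lemma map_Letter_inject: "map Letter xs = map Letter ys \<longleftrightarrow> xs = ys"
  by (simp add: inj_map_eq_map inj_def)

text \<open>The words between blocks contain letters only, so the last block of a sequence can be recognized.\<close>

lemma last_block_unique:
  assumes "xs @ Block x # map Letter us = ys @ Block y # map Letter vs"
  shows "xs = ys \<and> x = y \<and> us = vs"
  using assms
proof (induction us arbitrary: vs rule: rev_induct)
  case Nil
  then show ?case by (cases vs rule: rev_cases) auto
next
  case (snoc a us)
  then show ?case by (cases vs rule: rev_cases) (auto simp flip: append_assoc append_Cons)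
qed

lemma tokens_eqD:
  "tokens u p n = tokens v r m \<Longrightarrow> n = m \<and> (\<forall>i\<in>{0..n}. u i = v i) \<and> (\<forall>j\<in>{1..n}. p j = r j)"
proof (induction n arbitrary: m)
  case 0
  have "m = 0"
  proof (cases m)
    case (Suc k)
    then have "Block (r (Suc k)) \<in> set (tokens v r m)" by simp
    then show ?thesis using 0 by (auto simp flip: 0)
  qed
  then show ?case using 0 by (simp add: map_Letter_inject)
next
  case (Suc n)
  show ?case
  proof (cases m)
    case 0
    have "Block (p (Suc n)) \<in> set (tokens u p (Suc n))" by simp
    then show ?thesis unfolding Suc.prems 0 by auto
  next
    case (Suc k)
    then have "tokens u p n = tokens v r k \<and> p (Suc n) = r (Suc k) \<and> u (Suc n) = v (Suc k)"
      using Suc.prems last_block_unique by (metis tokens.simps(2))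
    with Suc.IH[of k] Suc show ?thesis by (auto simp: le_Suc_eq)
  qed
qed

context bidet_alphabet
begin

definition pr :: "'a pseudoword option \<Rightarrow> 'a pseudoword option" where
  "pr = map_option (proj V A)"

lemma proj_mult:
  "proj V A (x \<cdot>\<^bsub>Omega fin_semigrps A\<^esub> y) = proj V A x \<cdot>\<^bsub>Omega V A\<^esub> proj V A y"
  using V_fin by (auto simp: proj_def Omega_def pro_index_def fun_eq_iff)

lemma proj_in: "x \<in> carrier (Omega fin_semigrps A) \<Longrightarrow> proj V A x \<in> carrier (Omega V A)"
  using proj_characterization(1)[OF V_fin] by (auto simp: semigrp_hom_def)

lemma pr_mult: "pr (x \<cdot>\<^bsub>adj_id (Omega fin_semigrps A)\<^esub> y) = pr x \<odot> pr y"
  by (cases x; cases y) (simp_all add: pr_def proj_mult)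

lemma pr_word: "pr (word_val A w) = wd w"
  by (simp add: pr_def word_val_def word_elem_def proj_characterization(3)[OF V_fin])

lemma regular_unbroken_Some:
  assumes "regular_elem (Omega V A) x"
  shows "unbroken (Some x)"
proof -
  obtain y where "x \<in> carrier (Omega V A)" "y \<in> carrier (Omega V A)"
    "x = x \<cdot>\<^bsub>Omega V A\<^esub> y \<cdot>\<^bsub>Omega V A\<^esub> x" using assms unfolding regular_elem_def by blast
  then show ?thesis
    using Omega_is_semigrp by (intro regular_unbroken[of _ "Some y"]) (simp_all add: is_semigrp_def)
qed

lemma sprod_regular_unbroken:
  assumes "rs \<noteq> []" "\<forall>r\<in>set rs. regular_elem (Omega V A) r"
  shows "unbroken (Some (sprod (Omega V A) rs))"
  using assms
proof (induction "Omega V A" rs rule: sprod.induct)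
  case (1 x)
  then show ?case using regular_unbroken_Some by simp
next
  case (2 x y ys)
  have "sprod (Omega V A) (y # ys) \<in> carrier (Omega V A)"
    using 2 Omega_is_semigrp by (intro sprod_closed) (auto simp: regular_elem_def)
  moreover have "x \<in> carrier (Omega V A)" using 2 by (simp add: regular_elem_def)
  ultimately have "unbroken (Some x \<odot> Some (sprod (Omega V A) (y # ys)))"
    using 2 regular_unbroken_Some by (intro unbroken_mult) simp_all
  then show ?case by simp
qed simp

text \<open>Multiregularity of the blocks serves to exclude good cuts inside them.\<close>

lemma multiregular_unbroken:
  assumes "multiregular V A \<pi>"
  shows "unbroken (Some (proj V A \<pi>))"
  using assms sprod_regular_unbroken unfolding multiregular_def by auto

lemma right_break_falls:
  assumes "right_break V A \<pi> a"
  shows "falls_R M (Some (proj V A \<pi>)) (lt a)"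
proof -
  have "Some (proj V A \<pi>) \<noteq> (Some (proj V A \<pi>) \<odot> lt a) \<odot> z" if "z \<in> carrier M" for z
    using assms that unfolding right_break_def less_R_def le_R_def
    by (simp add: proj_mult proj_characterization(3)[OF V_fin])
  then show ?thesis unfolding falls_R_def by metis
qed

lemma left_break_falls:
  assumes "left_break V A a \<pi>" and "a \<in> A" and "\<pi> \<in> carrier (Omega fin_semigrps A)"
  shows "falls_L M (lt a) (Some (proj V A \<pi>))"
proof -
  have "Some (proj V A \<pi>) \<noteq> z \<odot> lt a \<odot> Some (proj V A \<pi>)" if "z \<in> carrier M" for z
    using assms(1) that unfolding left_break_def less_L_def le_L_def
    by (simp add: proj_mult proj_characterization(3)[OF V_fin])
  moreover have "(z \<odot> lt a) \<odot> Some (proj V A \<pi>) = z \<odot> lt a \<odot> Some (proj V A \<pi>)" if "z \<in> carrier M" for z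
    using that assms proj_in by (intro M_assoc lt_in) simp_all
  ultimately show ?thesis unfolding falls_L_def by metis
qed

lemma tokens_val:
  assumes "\<forall>t\<in>set (tokens u (\<lambda>i. Some (proj V A (p i))) n). admissible t"
  shows "pr (fact_val A u p n) = val (tokens u (\<lambda>i. Some (proj V A (p i))) n)"
proof -
  have word: "wd w = val (map Letter w)" if "w \<in> lists A" for w
    using that
  proof (induction w)
    case Nil
    then show ?case by (simp add: word_elem_def)
  next
    case (Cons a w)
    then show ?case using wd_append[of "[a]" w] by (simp add: wd_letter)
  qed
  show ?thesis
    using assms
  proof (induction n)
    case 0
    then have "u 0 \<in> lists A" by auto
    then show ?case by (simp add: pr_word word)
  next
    case (Suc k)
    let ?p = "\<lambda>i. Some (proj V A (p i))"
    have adm: "\<forall>t\<in>set (tokens u ?p k). admissible t" "admissible (Block (?p (Suc k)))"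
      "\<forall>t\<in>set (map Letter (u (Suc k)) :: ('a, _) token list). admissible t"
      using Suc.prems by auto
    then have u: "u (Suc k) \<in> lists A" by auto
    have "val (tokens u ?p (Suc k)) = val (tokens u ?p k) \<odot> ?p (Suc k) \<odot> val (map Letter (u (Suc k)))"
      using Suc.prems by (simp only: tokens.simps, subst val_append) auto
    also have "\<dots> = (val (tokens u ?p k) \<odot> ?p (Suc k)) \<odot> val (map Letter (u (Suc k)))"
      using adm val_in[OF adm(1)] val_in[OF adm(3)] by (intro M_assoc[symmetric]) simp_all
    also have "\<dots> = pr (fact_val A u p (Suc k))"
      using Suc.IH adm(1) word[OF u] by (simp add: pr_mult pr_word) (simp add: pr_def)
    finally show ?case by simp
  qed
qed

text \<open>Proved for all prefixes of the factorization that end in a word \<open>u\<^sub>k\<close>. For \<open>0 < k < n\<close> this word is nonempty,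
  which separates the blocks.\<close>

lemma tokens_organized:
  assumes fact: "factorization A \<pi> n u p" and mr: "multiregularly_organized V A n p"
    and sb: "short_breaks V A n u p" and "k \<le> n"
  shows "organized (tokens u (\<lambda>i. Some (proj V A (p i))) k)"
  using \<open>k \<le> n\<close>
proof (induction k)
  have letters: "set (u i) \<subseteq> A" if "i \<le> n" for i
    using fact that unfolding factorization_def words_def by (cases "i = 0"; cases "i = n") auto
  have word: "organized (map Letter (u i))" if "i \<le> n" for i
  proof -
    have "successively compatible (map Letter w)" for w
      by (induction w rule: induct_list012) simp_all
    then show ?thesis using letters[OF that] unfolding organized_def by auto
  qed
  {
    case 0
    show ?case using word by simp
  next
    case (Suc k)
    let ?p = "\<lambda>i. Some (proj V A (p i))"
    let ?ts = "tokens u ?p k"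
    have p: "p (Suc k) \<in> carrier (Omega fin_semigrps A)" using fact Suc.prems by (simp add: factorization_def)
    have adm: "admissible (Block (?p (Suc k)))"
      using proj_in[OF p] multiregular_unbroken mr Suc.prems by (simp add: multiregularly_organized_def)
    have left: "compatible (last ?ts) (Block (?p (Suc k)))" if ne: "?ts \<noteq> []"
    proof -
      have uk: "u k \<noteq> []"
        using ne fact Suc.prems unfolding factorization_def words_def by (cases k) auto
      then have last: "last ?ts = Letter (last (u k))" by (cases k) (simp_all add: last_map)
      have "left_break V A (last (u k)) (p (Suc k))"
        using sb Suc.prems uk unfolding short_breaks_def by (cases k) auto
      moreover have "last (u k) \<in> A" using uk letters[of k] Suc.prems last_in_set[of "u k"] by auto
      ultimately show ?thesis using left_break_falls p last by simp
    qed
    have right: "compatible (Block (?p (Suc k))) (hd (map Letter (u (Suc k))))" if ne: "u (Suc k) \<noteq> []"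
    proof -
      have "right_break V A (p (Suc k)) (hd (u (Suc k)))"
        using sb Suc.prems ne unfolding short_breaks_def by (cases "Suc k = n") auto
      then show ?thesis using right_break_falls ne by (simp add: hd_map)
    qed
    show ?case
      using Suc word[of "Suc k"] adm left right by (auto simp: organized_append organized_Cons)
  }
qed

lemma organized_factorization_unique:
  assumes "models V A \<pi> \<rho>"
    and "factorization A \<pi> n u p" "multiregularly_organized V A n p" "short_breaks V A n u p"
    and "factorization A \<rho> m v r" "multiregularly_organized V A m r" "short_breaks V A m v r"
  shows "n = m \<and> (\<forall>i\<in>{0..n}. u i = v i) \<and> (\<forall>j\<in>{1..n}. models V A (p j) (r j))"
proof -
  let ?p = "\<lambda>i. Some (proj V A (p i))" and ?r = "\<lambda>i. Some (proj V A (r i))"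
  have ts: "organized (tokens u ?p n)" "organized (tokens v ?r m)"
    using tokens_organized assms by blast+
  then have "val (tokens u ?p n) = pr (Some \<pi>)" "val (tokens v ?r m) = pr (Some \<rho>)"
    using tokens_val[of u p n] tokens_val[of v r m] assms(2,5) by (simp_all add: organized_def factorization_def)
  moreover have "pr (Some \<pi>) = pr (Some \<rho>)" using assms(1) by (simp add: pr_def models_def)
  ultimately have "tokens u ?p n = tokens v ?r m" using organized_unique ts by simp
  from tokens_eqD[OF this] show ?thesis by (simp add: models_def)
qed

end

theorem theorem7p2:
  fixes V :: "nat semigrp set" and A :: "'a set"
    and \<pi> \<rho> :: "'a pseudoword" and n m :: nat
    and u v :: "nat \<Rightarrow> 'a list" and p r :: "nat \<Rightarrow> 'a pseudoword"
  assumes "pseudovariety V" and "bidet_closed V"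
    and "finite A"
    and "\<pi> \<in> carrier (Omega fin_semigrps A)" and "\<rho> \<in> carrier (Omega fin_semigrps A)"
    and "models V A \<pi> \<rho>"
    and "factorization A \<pi> n u p"
    and "multiregularly_organized V A n p" and "short_breaks V A n u p"
    and "factorization A \<rho> m v r"
    and "multiregularly_organized V A m r" and "short_breaks V A m v r"
  shows "n = m \<and> (\<forall>i\<in>{0..n}. u i = v i) \<and> (\<forall>j\<in>{1..n}. models V A (p j) (r j))"
proof -
  have "A \<noteq> {}" using assms(4) by (auto simp: Omega_def words_def)
  then interpret bidet_alphabet V A
    using assms by unfold_locales
  show ?thesis using organized_factorization_unique assms(6-12) .
qed

end
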